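(* Let $V$ be a finite dimensional complex vector space with basis $v_1,\dots,v_n$, and take $G=\{1\}$. Then the Gerstenhaber bracket on $\mathrm{HH}^\bullet(S(V))$, realized on $S(V)\otimes\bigwedge^\bullet V^*$, is the classical Schouten–Nijenhuis bracket: for $\alpha=f_1\otimes dv_J$ in degree $p$ and $\beta=f_2\otimes dv_L$ in degree $q$, with $f_1,f_2\in S(V)$, $J=(j_1,\dots,j_p)$, $L=(l_1,\dots,l_q)$, $$[\alpha,\beta]=\sum_{1\le k\le p}(-1)^{(q-1)(k-1)}\frac{\partial}{\partial v_{j_k}}(f_2)\,f_1\otimes dv_{I_k}\;-\;(-1)^{(p-1)(q-1)}\sum_{1\le k\le q}(-1)^{(p-1)(k-1)}\frac{\partial}{\partial v_{l_k}}(f_1)\,f_2\otimes dv_{I'_k},$$ where $I_k=(j_1,\dots,j_{k-1},l_1,\dots,l_q,j_{k+1},\dots,j_p)$ and $I'_k=(l_1,\dots,l_{k-1},j_1,\dots,j_p,l_{k+1},\dots,l_q)$.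
   Context: For a multi-index $I=(i_1,\dots,i_m)$, $dv_I=v_{i_1}^*\wedge\cdots\wedge v_{i_m}^*$, with $v_i^*$ the dual basis of $V^*$. $S(V)$ is the symmetric algebra; $\mathrm{HH}^\bullet(S(V))=\mathrm{Ext}^\bullet_{S(V)^e}(S(V),S(V))$, computed by bar cochains $\mathrm{Hom}_{\mathbb C}(S(V)^{\otimes p},S(V))$, with Gerstenhaber bracket $[f,f']=f\,\overline\circ\, f'-(-1)^{(p-1)(q-1)}f'\,\overline\circ\, f$ for $f,f'$ of degrees $p,q$, where $(f\,\overline\circ\, f')(a_1\otimes\cdots\otimes a_{p+q-1})=\sum_{k=1}^p(-1)^{(q-1)(k-1)}f(a_1\otimes\cdots\otimes a_{k-1}\otimes f'(a_k\otimes\cdots\otimes a_{k+q-1})\otimes a_{k+q}\otimes\cdots\otimes a_{p+q-1})$. The identification $\mathrm{HH}^p(S(V))\cong S(V)\otimes\bigwedge^pV^*\cong\mathrm{Hom}_{\mathbb C}(\bigwedge^pV,S(V))$ sends the class of a cocycle $f$ to the map $x_1\wedge\cdots\wedge x_p\mapsto\sum_{\pi\in\mathrm{Sym}_p}\mathrm{sgn}(\pi)f(x_{\pi(1)}\otimes\cdots\otimes x_{\pi(p)})$, where $(x_1^*\wedge\cdots\wedge x_p^* )(y_1\wedge\cdots\wedge y_p)=\det(x_i^*(y_j))$. *)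

theory Defs
  imports
    Complex_Main
    "HOL-Library.Poly_Mapping"
    "HOL-Combinatorics.Permutations"
    "Jordan_Normal_Form.Determinant"
begin

section \<open>Complex vector spaces and algebras\<close>

text \<open>
  The symmetric algebra is built below as a type depending on the vector space, so the
  scalar multiplication has to be a class parameter.
\<close>

class complex_vector = ab_group_add +
  fixes scaleC :: "complex \<Rightarrow> 'a \<Rightarrow> 'a"  (infixr \<open>*\<^sub>C\<close> 75)
  assumes scaleC_add_right: "c *\<^sub>C (x + y) = c *\<^sub>C x + c *\<^sub>C y"
    and scaleC_add_left: "(c + d) *\<^sub>C x = c *\<^sub>C x + d *\<^sub>C x"
    and scaleC_scaleC: "c *\<^sub>C (d *\<^sub>C x) = (c * d) *\<^sub>C x"
    and scaleC_one: "1 *\<^sub>C x = x"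

global_interpretation complex_vector: vector_space "scaleC :: complex \<Rightarrow> 'a \<Rightarrow> 'a::complex_vector"
  by unfold_locales
    (simp_all add: scaleC_add_right scaleC_add_left scaleC_scaleC scaleC_one)

class complex_algebra_1 = complex_vector + ring_1 +
  assumes mult_scaleC_left: "(c *\<^sub>C x) * y = c *\<^sub>C (x * y)"
    and mult_scaleC_right: "x * (c *\<^sub>C y) = c *\<^sub>C (x * y)"

abbreviation clinear :: "('a::complex_vector \<Rightarrow> 'b::complex_vector) \<Rightarrow> bool"
  where "clinear \<equiv> Vector_Spaces.linear scaleC scaleC"


section \<open>The symmetric algebra\<close>

text \<open>
  \<open>S(V)\<close> is the free commutative algebra on the underlying set of \<open>V\<close>, that is, the
  polynomial ring with one variable \<open>X\<^sub>u\<close> for every vector \<open>u\<close>, modulo the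
  ideal generated by all \<open>X\<^bsub>u+w\<^esub> - X\<^sub>u - X\<^sub>w\<close> and
  \<open>X\<^bsub>cu\<^esub> - c X\<^sub>u\<close>.
\<close>

type_synonym 'v free_calg = "('v \<Rightarrow>\<^sub>0 nat) \<Rightarrow>\<^sub>0 complex"

definition free_var :: "'v \<Rightarrow> 'v free_calg"
  where "free_var u = Poly_Mapping.single (Poly_Mapping.single u 1) 1"

definition free_const :: "complex \<Rightarrow> 'v free_calg"
  where "free_const c = Poly_Mapping.single 0 c"

lemma free_const_simps:
  "free_const (c + d) = free_const c + free_const d"
  "free_const (c * d) = free_const c * free_const d"
  "free_const 1 = 1"
  by (simp_all add: free_const_def single_add mult_single)

lemma module_mult: "Modules.module ((*) :: 'r::comm_ring_1 \<Rightarrow> 'r \<Rightarrow> 'r)"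
  by unfold_locales (simp_all add: algebra_simps)

text \<open>The ideal generated by a set is its span in the ring regarded as a module over itself.\<close>

definition sym_ideal :: "'v::complex_vector free_calg set"
  where "sym_ideal = Modules.module.span (*)
    ({free_var (u + w) - free_var u - free_var w | u w. True} \<union>
     {free_var (c *\<^sub>C u) - free_const c * free_var u | c u. True})"

lemma sym_ideal_zero: "0 \<in> sym_ideal"
  and sym_ideal_add: "a \<in> sym_ideal \<Longrightarrow> b \<in> sym_ideal \<Longrightarrow> a + b \<in> sym_ideal"
  and sym_ideal_uminus: "a \<in> sym_ideal \<Longrightarrow> - a \<in> sym_ideal"
  and sym_ideal_mult: "a \<in> sym_ideal \<Longrightarrow> r * a \<in> sym_ideal"
  unfolding sym_ideal_def
  by (fact Modules.module.span_zero[OF module_mult] Modules.module.span_add[OF module_mult]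
      Modules.module.span_neg[OF module_mult] Modules.module.span_scale[OF module_mult])+

lemma lookup_mult_zero:
  fixes a b :: "'v free_calg"
  shows "Poly_Mapping.lookup (a * b) 0 = Poly_Mapping.lookup a 0 * Poly_Mapping.lookup b 0"
proof -
  have *: "0 = l + m \<longleftrightarrow> l = 0 \<and> m = 0" for l m :: "'v \<Rightarrow>\<^sub>0 nat"
    by (auto simp: poly_mapping_eq_iff plus_poly_mapping.rep_eq fun_eq_iff)
  have "Poly_Mapping.lookup (a * b) 0 = Sum_any (\<lambda>l. Poly_Mapping.lookup a l *
      Sum_any (\<lambda>m. Poly_Mapping.lookup b m when l = 0 \<and> m = 0))"
    by (simp add: lookup_mult *)
  also have "\<dots> = Sum_any (\<lambda>l. Poly_Mapping.lookup a l * Poly_Mapping.lookup b 0 when l = 0)"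
    by (rule Sum_any.cong) (auto simp: when_def)
  finally show ?thesis
    by simp
qed

lemma sym_ideal_lookup_zero:
  fixes a :: "'v::complex_vector free_calg"
  assumes "a \<in> sym_ideal"
  shows "Poly_Mapping.lookup a 0 = 0"
proof -
  have "Poly_Mapping.single u (1 :: nat) \<noteq> 0" for u :: 'v
    by (metis lookup_single_eq lookup_zero zero_neq_one)
  then have *: "Poly_Mapping.lookup (free_var u) 0 = 0" for u :: 'v
    by (simp add: free_var_def lookup_single when_def)
  show ?thesis
    using assms unfolding sym_ideal_def
    by (induction rule: Modules.module.span_induct_alt[OF module_mult, consumes 1])
      (auto simp: lookup_add lookup_minus lookup_mult_zero *)
qed

definition sym_rel :: "'v::complex_vector free_calg \<Rightarrow> 'v free_calg \<Rightarrow> bool"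
  where "sym_rel a b \<longleftrightarrow> a - b \<in> sym_ideal"

lemma equivp_sym_rel: "equivp sym_rel"
proof (rule equivpI)
  show "reflp sym_rel"
    by (rule reflpI) (simp add: sym_rel_def sym_ideal_zero)
  show "symp sym_rel"
    by (rule sympI) (use sym_ideal_uminus in \<open>fastforce simp: sym_rel_def\<close>)
  show "transp sym_rel"
    by (rule transpI) (use sym_ideal_add in \<open>fastforce simp: sym_rel_def\<close>)
qed

quotient_type (overloaded) 'v sym = "'v::complex_vector free_calg" / sym_rel
  by (rule equivp_sym_rel)

instantiation sym :: (complex_vector) comm_ring_1
begin

lift_definition zero_sym :: "'a sym" is 0 .
lift_definition one_sym :: "'a sym" is 1 .

lift_definition plus_sym :: "'a sym \<Rightarrow> 'a sym \<Rightarrow> 'a sym" is "(+)"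
  unfolding sym_rel_def by (metis add_diff_add sym_ideal_add)

lift_definition uminus_sym :: "'a sym \<Rightarrow> 'a sym" is uminus
  unfolding sym_rel_def by (metis minus_diff_minus sym_ideal_uminus)

definition minus_sym :: "'a sym \<Rightarrow> 'a sym \<Rightarrow> 'a sym"
  where "minus_sym a b = a + - b"

lift_definition times_sym :: "'a sym \<Rightarrow> 'a sym \<Rightarrow> 'a sym" is "(*)"
proof -
  fix a a' b b' :: "'a free_calg"
  assume "sym_rel a a'" "sym_rel b b'"
  then have "b' * (a - a') + a * (b - b') \<in> sym_ideal"
    unfolding sym_rel_def by (intro sym_ideal_add sym_ideal_mult)
  also have "b' * (a - a') + a * (b - b') = a * b - a' * b'"
    by (simp add: algebra_simps)
  finally show "sym_rel (a * b) (a' * b')"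
    unfolding sym_rel_def .
qed

instance
proof
  fix a b c :: "'a sym"
  show "a + b + c = a + (b + c)" "a + b = b + a" "0 + a = a" "- a + a = 0"
    "a * b * c = a * (b * c)" "a * b = b * a" "1 * a = a" "(a + b) * c = a * c + b * c"
    by (transfer, simp add: algebra_simps equivp_reflp[OF equivp_sym_rel])+
  show "a - b = a + - b"
    by (fact minus_sym_def)
  show "(0 :: 'a sym) \<noteq> 1"
    by transfer (use sym_ideal_uminus sym_ideal_lookup_zero in \<open>fastforce simp: sym_rel_def\<close>)
qed

end

instantiation sym :: (complex_vector) complex_algebra_1
begin

lift_definition scaleC_sym :: "complex \<Rightarrow> 'a sym \<Rightarrow> 'a sym" is "\<lambda>c a. free_const c * a"
  unfolding sym_rel_def by (metis right_diff_distrib sym_ideal_mult)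

instance
  by standard
    (transfer, simp add: free_const_simps algebra_simps equivp_reflp[OF equivp_sym_rel])+

end

lift_definition sym_incl :: "'v::complex_vector \<Rightarrow> 'v sym" is free_var .

lemma clinear_sym_incl: "clinear sym_incl"
proof (unfold_locales, goal_cases)
  case (1 u w)
  have "free_var (u + w) - free_var u - free_var w \<in> sym_ideal"
    unfolding sym_ideal_def by (intro Modules.module.span_base[OF module_mult]) blast
  then show ?case
    by transfer (simp add: sym_rel_def algebra_simps)
next
  case (2 c u)
  have "free_var (c *\<^sub>C u) - free_const c * free_var u \<in> sym_ideal"
    unfolding sym_ideal_def by (intro Modules.module.span_base[OF module_mult]) blast
  then show ?case
    by transfer (simp add: sym_rel_def)
qed


section \<open>Hochschild cohomology and the Gerstenhaber bracket\<close>

text \<open>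
  A bar cochain in \<open>Hom(A\<^sup>\<otimes>\<^sup>p, A)\<close> is a multilinear map on the lists of length \<open>p\<close>,
  extended by \<open>0\<close> to all other lists so that cochains are determined by their values.
\<close>

definition bar_cochains :: "nat \<Rightarrow> ('a::complex_algebra_1 list \<Rightarrow> 'a) set"
  where "bar_cochains p = {f.
    (\<forall>as. length as \<noteq> p \<longrightarrow> f as = 0) \<and>
    (\<forall>as i. length as = p \<longrightarrow> i < p \<longrightarrow> clinear (\<lambda>a. f (as[i := a])))}"

definition hochschild_d ::
    "nat \<Rightarrow> ('a::complex_algebra_1 list \<Rightarrow> 'a) \<Rightarrow> 'a list \<Rightarrow> 'a"
  where "hochschild_d p f as = (if length as = p + 1 then
      hd as * f (tl as)
      + (\<Sum>k=1..p. (- 1) ^ k * f (take (k - 1) as @ [as ! (k - 1) * as ! k] @ drop (k + 1) as))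
      + (- 1) ^ (p + 1) * (f (butlast as) * last as)
    else 0)"

definition hochschild_cocycles :: "nat \<Rightarrow> ('a::complex_algebra_1 list \<Rightarrow> 'a) set"
  where "hochschild_cocycles p = {f \<in> bar_cochains p. hochschild_d p f = (\<lambda>_. 0)}"

definition hochschild_coboundaries :: "nat \<Rightarrow> ('a::complex_algebra_1 list \<Rightarrow> 'a) set"
  where "hochschild_coboundaries p =
    (case p of 0 \<Rightarrow> {\<lambda>_. 0} | Suc m \<Rightarrow> hochschild_d m ` bar_cochains m)"

definition cohomologous :: "nat \<Rightarrow> ('a::complex_algebra_1 list \<Rightarrow> 'a) rel"
  where "cohomologous p = {(f, g). f \<in> hochschild_cocycles p \<and> g \<in> hochschild_cocycles p \<and>
    (\<lambda>as. f as - g as) \<in> hochschild_coboundaries p}"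

definition HH :: "nat \<Rightarrow> ('a::complex_algebra_1 list \<Rightarrow> 'a) set set"
  where "HH p = hochschild_cocycles p // cohomologous p"

text \<open>
  In the signs \<open>p - 1\<close> can be \<open>-1\<close>, so their exponents are integers. For \<open>p = q = 0\<close> all
  brackets lie in degree \<open>-1\<close> and vanish; below, truncated subtraction on \<open>nat\<close> files
  the zero cochain under degree \<open>0\<close> instead.
\<close>

definition circle_product :: "nat \<Rightarrow> nat \<Rightarrow> ('a::complex_algebra_1 list \<Rightarrow> 'a) \<Rightarrow>
    ('a list \<Rightarrow> 'a) \<Rightarrow> 'a list \<Rightarrow> 'a"
  where "circle_product p q f g as = (if length as + 1 = p + q then
      (\<Sum>k=1..p. (- 1) powi ((int q - 1) * (int k - 1)) *\<^sub>C
        f (take (k - 1) as @ [g (take q (drop (k - 1) as))] @ drop (k - 1 + q) as))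
    else 0)"

definition gerstenhaber :: "nat \<Rightarrow> nat \<Rightarrow> ('a::complex_algebra_1 list \<Rightarrow> 'a) \<Rightarrow>
    ('a list \<Rightarrow> 'a) \<Rightarrow> 'a list \<Rightarrow> 'a"
  where "gerstenhaber p q f g as = circle_product p q f g as
    - (- 1) powi ((int p - 1) * (int q - 1)) *\<^sub>C circle_product q p g f as"

definition HH_bracket :: "nat \<Rightarrow> nat \<Rightarrow> ('a::complex_algebra_1 list \<Rightarrow> 'a) set \<Rightarrow>
    ('a list \<Rightarrow> 'a) set \<Rightarrow> ('a list \<Rightarrow> 'a) set"
  where "HH_bracket p q X Y =
    (\<Union>f\<in>X. \<Union>g\<in>Y. cohomologous (p + q - 1) `` {gerstenhaber p q f g})"


section \<open>Polyvector fields\<close>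

text \<open>
  An element of \<open>S(V) \<otimes> \<Lambda>\<^sup>p V\<^sup>* = Hom(\<Lambda>\<^sup>p V, S(V))\<close> is represented by the alternating
  multilinear map sending the list \<open>[x\<^sub>1, \<dots>, x\<^sub>p]\<close> to the value at
  \<open>x\<^sub>1 \<and> \<dots> \<and> x\<^sub>p\<close>, again extended by \<open>0\<close> to lists of other lengths.
\<close>

definition antisymmetrize ::
    "nat \<Rightarrow> ('v::complex_vector sym list \<Rightarrow> 'v sym) \<Rightarrow> 'v list \<Rightarrow> 'v sym"
  where "antisymmetrize p f xs = (if length xs = p then
      (\<Sum>\<pi> | \<pi> permutes {..<p}. of_int (sign \<pi>) * f (map sym_incl (permute_list \<pi> xs)))
    else 0)"

text \<open>The map is constant on each class, so its image of a class is a singleton.\<close>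

definition hkr ::
    "nat \<Rightarrow> ('v::complex_vector sym list \<Rightarrow> 'v sym) set \<Rightarrow> 'v list \<Rightarrow> 'v sym"
  where "hkr p X = the_elem (antisymmetrize p ` X)"

text \<open>
  The Gerstenhaber bracket transported along the isomorphism \<open>hkr\<close> from \<open>HH\<^sup>p(S(V))\<close> to
  \<open>Hom(\<Lambda>\<^sup>p V, S(V))\<close>.
\<close>

definition polyvector_bracket :: "nat \<Rightarrow> nat \<Rightarrow> ('v::complex_vector list \<Rightarrow> 'v sym) \<Rightarrow>
    ('v list \<Rightarrow> 'v sym) \<Rightarrow> 'v list \<Rightarrow> 'v sym"
  where "polyvector_bracket p q \<alpha> \<beta> = hkr (p + q - 1)
    (HH_bracket p q (inv_into (HH p) (hkr p) \<alpha>) (inv_into (HH q) (hkr q) \<beta>))"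

text \<open>In the remaining definitions \<open>v 1, \<dots>, v n\<close> is a basis of \<open>V\<close>.\<close>

definition is_basis :: "nat \<Rightarrow> (nat \<Rightarrow> 'v::complex_vector) \<Rightarrow> bool"
  where "is_basis n v \<longleftrightarrow> inj_on v {1..n} \<and> complex_vector.independent (v ` {1..n}) \<and>
    complex_vector.span (v ` {1..n}) = UNIV"

definition dual_basis :: "nat \<Rightarrow> (nat \<Rightarrow> 'v::complex_vector) \<Rightarrow> nat \<Rightarrow> 'v \<Rightarrow> complex"
  where "dual_basis n v j x = complex_vector.representation (v ` {1..n}) x (v j)"

text \<open>The partial derivative is the unique derivation dual to the given generator.\<close>

definition partial_deriv ::
    "nat \<Rightarrow> (nat \<Rightarrow> 'v::complex_vector) \<Rightarrow> nat \<Rightarrow> 'v sym \<Rightarrow> 'v sym"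
  where "partial_deriv n v j = (THE D. clinear D \<and> (\<forall>a b. D (a * b) = D a * b + a * D b) \<and>
    (\<forall>i\<in>{1..n}. D (sym_incl (v i)) = (if i = j then 1 else 0)))"

text \<open>\<open>polyvector n v f J\<close> is \<open>f \<otimes> dv\<^sub>J\<close>; the entries of \<open>J\<close> may repeat or be unordered.\<close>

definition polyvector :: "nat \<Rightarrow> (nat \<Rightarrow> 'v::complex_vector) \<Rightarrow> 'v sym \<Rightarrow> nat list \<Rightarrow>
    'v list \<Rightarrow> 'v sym"
  where "polyvector n v f J xs = (if length xs = length J then
      det (mat (length J) (length J) (\<lambda>(i, k). dual_basis n v (J ! i) (xs ! k))) *\<^sub>C f
    else 0)"

end

theory Submission
  imports Defs
begin

text \<open>
  Let \<open>x\<close> be an element of \<open>S(V)\<close>, a \<open>0\<close>-cocycle by commutativity. Antisymmetrizing \<open>f\<close> amounts to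
  composing it successively with its arguments, \<open>f \<mapsto> f \<circ> x\<close>. By Gerstenhaber's homotopy formula
  \<open>f \<mapsto> f \<circ> x\<close> anticommutes with the differential, so it preserves cocycles, and after all but one
  argument it reaches \<open>1\<close>-cocycles, which are derivations and hence determined on \<open>V\<close>. The pre-Lie
  identity \<open>(f \<circ> g) \<circ> x = f \<circ> (g \<circ> x) \<plusminus> (f \<circ> x) \<circ> g\<close> then shows by induction that the
  antisymmetrization of \<open>f \<circ> g\<close> on \<open>V\<close> depends only on those of \<open>f\<close> and \<open>g\<close>. It can thus be
  evaluated on the cocycles
  \<open>a\<^sub>1 \<otimes> \<dots> \<otimes> a\<^sub>p \<mapsto> f\<^sub>1 \<cdot> \<partial>a\<^sub>1/\<partial>v\<^bsub>j\<^sub>1\<^esub> \<cdots> \<partial>a\<^sub>p/\<partial>v\<^bsub>j\<^sub>p\<^esub>\<close>, where the factors other than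
  \<open>\<partial>f\<^sub>2/\<partial>v\<^bsub>j\<^sub>k\<^esub>\<close> are constant on \<open>V\<close> and antisymmetrize to a determinant by the Leibniz formula.
\<close>

section \<open>Linear maps and signs\<close>

lemma clinearI:
  fixes f :: "'a::complex_vector \<Rightarrow> 'b::complex_vector"
  assumes "\<And>x y. f (x + y) = f x + f y" "\<And>c x. f (c *\<^sub>C x) = c *\<^sub>C f x"
  shows "clinear f"
  using assms by unfold_locales

lemma clinear_add: "clinear f \<Longrightarrow> f (x + y) = f x + f y"
  and clinear_scale: "clinear f \<Longrightarrow> f (c *\<^sub>C x) = c *\<^sub>C f x"
  by (simp_all add: Vector_Spaces.linear_iff)

lemma clinear_zero: "clinear f \<Longrightarrow> f 0 = 0"
  using clinear_add[of f 0 0] by simp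

lemma clinear_uminus: "clinear f \<Longrightarrow> f (- x) = - f x"
  using clinear_add[of f x "- x"] clinear_zero[of f] by (simp add: eq_neg_iff_add_eq_0 add.commute)

lemma clinear_sum: "clinear f \<Longrightarrow> f (\<Sum>i\<in>A. g i) = (\<Sum>i\<in>A. f (g i))"
  by (induction A rule: infinite_finite_induct) (simp_all add: clinear_add clinear_zero)

lemma clinear_sign:
  fixes f :: "'a::complex_algebra_1 \<Rightarrow> 'b::complex_algebra_1"
  shows "clinear f \<Longrightarrow> f ((- 1) ^ n * x) = (- 1) ^ n * f x"
  by (cases "even n") (simp_all add: clinear_uminus)

lemma scaleC_zero_right: "c *\<^sub>C 0 = (0 :: 'a::complex_vector)"
  using scaleC_add_right[of c 0 0] by simp

lemma scaleC_minus_one: "(- 1) *\<^sub>C x = - (x :: 'a::complex_vector)"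
  using scaleC_add_left[of "- 1" 1 x] scaleC_add_left[of 0 0 x]
  by (simp add: scaleC_one eq_neg_iff_add_eq_0)

text \<open>Only the parity of the exponent matters. Integer exponents such as
  \<open>int q - 1\<close> thus become natural ones such as \<open>q + 1\<close>, and the scalar
  sign becomes a factor in the algebra, where ring arithmetic applies.\<close>

lemma scaleC_minus_one_powi:
  fixes x :: "'a::complex_algebra_1"
  assumes "even (m - int n)"
  shows "(- 1) powi m *\<^sub>C x = (- 1) ^ n * x"
  using assms
  by (cases "even n") (auto simp: power_int_minus_left scaleC_one scaleC_minus_one)

lemma clinear_add_fun: "clinear f \<Longrightarrow> clinear g \<Longrightarrow> clinear (\<lambda>x. f x + g x)"
  and clinear_mult_left: "clinear f \<Longrightarrow> clinear (\<lambda>x. a * f x)"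
  and clinear_mult_right: "clinear f \<Longrightarrow> clinear (\<lambda>x. f x * a)"
  for f g :: "'a::complex_vector \<Rightarrow> 'b::complex_algebra_1"
  by (auto intro!: clinearI simp: clinear_add clinear_scale scaleC_add_right algebra_simps
      mult_scaleC_left mult_scaleC_right)

lemma clinear_const_zero: "clinear (\<lambda>_. 0)"
  by (rule clinearI) (simp_all add: scaleC_zero_right)

lemma clinear_compose: "clinear f \<Longrightarrow> clinear g \<Longrightarrow> clinear (\<lambda>x. f (g x))"
  by (rule clinearI) (simp_all add: clinear_add clinear_scale)

lemma clinear_sum_fun:
  fixes f :: "'i \<Rightarrow> 'a::complex_vector \<Rightarrow> 'b::complex_algebra_1"
  shows "(\<And>i. i \<in> A \<Longrightarrow> clinear (f i)) \<Longrightarrow> clinear (\<lambda>x. \<Sum>i\<in>A. f i x)"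
  by (induction A rule: infinite_finite_induct)
    (simp_all add: clinear_const_zero clinear_add_fun)

lemma clinear_diff_fun:
  fixes f g :: "'a::complex_vector \<Rightarrow> 'b::complex_algebra_1"
  assumes "clinear f" "clinear g"
  shows "clinear (\<lambda>x. f x - g x)"
  using clinear_add_fun[OF assms(1) clinear_mult_left[OF assms(2), of "- 1"]] by simp

section \<open>Multilinear cochains and contractions\<close>

text \<open>Multilinearity in the form in which contracted lists present it: the varied entry stands
  between two explicit lists.\<close>

lemma bar_cochains_slot:
  assumes "f \<in> bar_cochains p" "length us + length vs + 1 = p"
  shows "clinear (\<lambda>a. f (us @ a # vs))"
proof -
  have "\<forall>as i. length as = p \<longrightarrow> i < p \<longrightarrow> clinear (\<lambda>a. f (as[i := a]))"
    using assms(1) by (simp add: bar_cochains_def)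
  from this[rule_format, of "us @ 0 # vs" "length us"] assms(2)
  have "clinear (\<lambda>a. f ((us @ 0 # vs)[length us := a]))"
    by simp
  then show ?thesis
    by simp
qed

lemma bar_cochains_outside: "f \<in> bar_cochains p \<Longrightarrow> length as \<noteq> p \<Longrightarrow> f as = 0"
  by (simp add: bar_cochains_def)

lemma bar_cochainsI:
  assumes "\<And>as. length as \<noteq> p \<Longrightarrow> f as = 0"
    and "\<And>us vs. length us + length vs + 1 = p \<Longrightarrow> clinear (\<lambda>a. f (us @ a # vs))"
  shows "f \<in> bar_cochains p"
  unfolding bar_cochains_def
proof (safe, fact assms(1))
  fix as :: "'a list" and i
  assume "p = length as" "i < length as"
  then show "clinear (\<lambda>a. f (as[i := a]))"
    using assms(2)[of "take i as" "drop (Suc i) as"] by (simp add: upd_conv_take_nth_drop)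
qed

lemma hochschild_cocyclesD:
  assumes "f \<in> hochschild_cocycles p"
  shows "f \<in> bar_cochains p" "hochschild_d p f as = 0"
  using assms by (auto simp: hochschild_cocycles_def dest: fun_cong)

text \<open>
  The summands of both \<open>f \<circ> g\<close> and the Hochschild differential of \<open>f\<close> are values of \<open>f\<close> on
  contracted lists: a block of \<open>q\<close> entries from position \<open>i\<close> (counted from \<open>0\<close>) is replaced by
  its image under \<open>g\<close>, respectively two neighbours by their product. With \<open>q = 0\<close> an element is inserted.
\<close>

definition contract :: "nat \<Rightarrow> ('a list \<Rightarrow> 'a) \<Rightarrow> nat \<Rightarrow> 'a list \<Rightarrow> 'a list"
  where "contract q g i as = take i as @ g (take q (drop i as)) # drop (i + q) as"

definition mult_pair :: "'a::times list \<Rightarrow> 'a"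
  where "mult_pair as = as ! 0 * as ! 1"

lemma length_contract: "i + q \<le> length as \<Longrightarrow> length (contract q g i as) = length as + 1 - q"
  by (simp add: contract_def)

lemma contract_append: "length us = i \<Longrightarrow> length bs = q \<Longrightarrow>
    contract q g i (us @ bs @ vs) = us @ g bs # vs"
  by (simp add: contract_def)

lemma list_split_at:
  assumes "i + q \<le> length as"
  shows "as = take i as @ take q (drop i as) @ drop (i + q) as"
  by (metis append_take_drop_id drop_drop add.commute)

lemma contract_appendE:
  assumes "i + q \<le> length as"
  obtains us bs vs where "as = us @ bs @ vs" "length us = i" "length bs = q"
  using list_split_at[OF assms] assms by (metis length_take length_drop min_absorb2 le_add1 le_trans
      diff_add_inverse add_le_imp_le_diff add.commute)

text \<open>Contracting the earlier block leaves one entry in place of \<open>q\<close>, which moves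
  the later block from \<open>k\<close> to \<open>k + 1 - q\<close>. As \<open>q \<le> k\<close>,
  the subtraction does not truncate.\<close>

lemma contract_contract_disjoint:
  assumes "i + q \<le> k" "k + l \<le> length as"
  shows "contract q g i (contract l h k as) = contract l h (k + 1 - q) (contract q g i as)"
proof -
  obtain us bs cs where as: "as = us @ bs @ cs" "length us = i" "length bs = q"
    using assms by (metis contract_appendE le_trans le_add1)
  have "k - i - q + l \<le> length cs"
    using assms as by simp
  then obtain ws ds es where cs: "cs = ws @ ds @ es" "length ws = k - i - q" "length ds = l"
    by (metis contract_appendE)
  have "contract l h k as = us @ bs @ ws @ h ds # es"
    using contract_append[of "us @ bs @ ws" k ds l h es] as cs assms by simp
  moreover have "contract q g i as = us @ g bs # ws @ ds @ es"
    using as cs by (simp add: contract_append)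
  moreover have "contract l h (k + 1 - q) ((us @ g bs # ws) @ ds @ es) = (us @ g bs # ws) @ h ds # es"
    using as cs assms by (intro contract_append) auto
  ultimately show ?thesis
    using as cs by (simp add: contract_append)
qed

text \<open>The block given to \<open>g\<close> contains the entry made by \<open>h\<close>, so it
  stems from \<open>q + l - 1\<close> entries of \<open>as\<close>. The assumptions force
  \<open>0 < q\<close>, so this difference does not truncate.\<close>

lemma contract_contract_nested:
  assumes "i \<le> k" "k < i + q" "i + q + l \<le> length as + 1"
  shows "contract q g i (contract l h k as) =
    take i as @ g (contract l h (k - i) (take (q + l - 1) (drop i as))) # drop (i + q + l - 1) as"
proof -
  have "i + (q + l - 1) \<le> length as"
    using assms by simp
  then obtain us bs vs where as: "as = us @ bs @ vs" "length us = i" "length bs = q + l - 1"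
    by (metis contract_appendE)
  have "k - i + l \<le> length bs"
    using assms as by simp
  then obtain ws cs xs where bs: "bs = ws @ cs @ xs" "length ws = k - i" "length cs = l"
    by (metis contract_appendE)
  have "contract l h k as = us @ (ws @ h cs # xs) @ vs"
    using contract_append[of "us @ ws" k cs l h "xs @ vs"] as bs assms by simp
  moreover have "length xs = q - 1 - (k - i)"
    using as bs assms by simp
  moreover have "i + q + l - 1 = length us + length bs"
    using as assms by simp
  then have "drop (i + q + l - 1) as = vs"
    using as by simp
  moreover have "contract q g i (us @ (ws @ h cs # xs) @ vs) = us @ g (ws @ h cs # xs) # vs"
    using as bs assms calculation(2) by (intro contract_append) auto
  moreover have "contract l h (k - i) bs = ws @ h cs # xs"
    using bs by (simp add: contract_append)
  moreover have "take (q + l - 1) (drop i as) = bs"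
    using as by simp
  moreover have "take i as = us"
    using as by simp
  moreover have "contract l h k as = us @ (ws @ h cs # xs) @ vs"
    using calculation(1) as(1) by (simp only: append_assoc append_Cons)
  ultimately show ?thesis
    by (simp only:)
qed

section \<open>Circle products and the Hochschild differential\<close>

lemma minus_one_power_left_commute: "x * ((- 1 :: 'a::ring_1) ^ n * y) = (- 1) ^ n * (x * y)"
  by (cases "even n") simp_all

lemma hochschild_d_eq:
  assumes "length as = p + 1"
  shows "hochschild_d p f as = hd as * f (tl as)
    + (\<Sum>k<p. (- 1) ^ (k + 1) * f (contract 2 mult_pair k as))
    + (- 1) ^ (p + 1) * (f (butlast as) * last as)"
proof -
  have "take k as @ [as ! k * as ! (k + 1)] @ drop (k + 2) as = contract 2 mult_pair k as"
    if "k < p" for k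
    using that assms by (simp add: contract_def mult_pair_def)
  then have "(\<Sum>k = Suc 0..p. (- 1) ^ k * f (take (k - 1) as @ [as ! (k - 1) * as ! k] @ drop (k + 1) as))
    = (\<Sum>k<p. (- 1) ^ (k + 1) * f (contract 2 mult_pair k as))"
    unfolding sum.atLeast1_atMost_eq by (intro sum.cong) simp_all
  then show ?thesis
    using assms by (simp add: hochschild_d_def)
qed

lemma circle_product_eq:
  assumes "length as + 1 = p + q"
  shows "circle_product p q f g as = (\<Sum>i<p. (- 1) ^ ((q + 1) * i) * f (contract q g i as))"
proof -
  have "(- 1) powi ((int q - 1) * (int (Suc i) - 1)) *\<^sub>C x = (- 1) ^ ((q + 1) * i) * x"
    for i and x :: 'a
    by (rule scaleC_minus_one_powi) (simp add: algebra_simps)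
  then have "(\<Sum>k = Suc 0..p. (- 1) powi ((int q - 1) * (int k - 1)) *\<^sub>C
        f (take (k - 1) as @ [g (take q (drop (k - 1) as))] @ drop (k - 1 + q) as)) =
    (\<Sum>i<p. (- 1) ^ ((q + 1) * i) * f (contract q g i as))"
    unfolding sum.atLeast1_atMost_eq by (intro sum.cong) (simp_all add: contract_def)
  then show ?thesis
    using assms by (simp add: circle_product_def)
qed

lemma circle_product_outside: "length as + 1 \<noteq> p + q \<Longrightarrow> circle_product p q f g as = 0"
  by (simp add: circle_product_def)

lemma circle_product_0 [simp]: "circle_product 0 q f g as = 0"
  by (simp add: circle_product_def)

text \<open>Later \<open>i\<close> is the position of the value of \<open>g\<close> in the
  contracted list and \<open>k\<close> that of the left factor of a product. Products left of the
  value in row \<open>i + 1\<close> are grouped with products right of it in row \<open>i\<close>;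
  \<open>\<phi> (i + 1) i\<close> and \<open>\<phi> i i\<close> are its products with the left and
  the right neighbour.\<close>

lemma sum_split_adjacent:
  fixes \<phi> :: "nat \<Rightarrow> nat \<Rightarrow> 'a::comm_monoid_add"
  shows "(\<Sum>i<p + 1. \<Sum>k<p. \<phi> i k) = (\<Sum>i<p. (\<Sum>k<i. \<phi> (i + 1) k) + \<phi> (i + 1) i + \<phi> i i
    + (\<Sum>k = i + 1..<p. \<phi> i k))"
proof -
  have split: "(\<Sum>k<p. \<phi> i k) = (\<Sum>k<i. \<phi> i k) + (\<Sum>k = i..<p. \<phi> i k)" if "i < p + 1" for i
    using that by (subst sum.union_disjoint[symmetric]) (auto intro!: sum.cong)
  have "(\<Sum>i<p + 1. \<Sum>k<p. \<phi> i k)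
    = (\<Sum>i<p + 1. \<Sum>k<i. \<phi> i k) + (\<Sum>i<p + 1. \<Sum>k = i..<p. \<phi> i k)"
    by (simp add: split sum.distrib del: sum.lessThan_Suc)
  also have "(\<Sum>i<p + 1. \<Sum>k<i. \<phi> i k) = (\<Sum>i<p. (\<Sum>k<i. \<phi> (i + 1) k) + \<phi> (i + 1) i)"
    unfolding Suc_eq_plus1[symmetric] sum.lessThan_Suc_shift[of _ p] by simp
  also have "(\<Sum>i<p + 1. \<Sum>k = i..<p. \<phi> i k) = (\<Sum>i<p. \<phi> i i + (\<Sum>k = i + 1..<p. \<phi> i k))"
    by (simp add: sum.atLeast_Suc_lessThan)
  finally show ?thesis
    by (simp add: sum.distrib ac_simps)
qed

text \<open>For positions before, inside and after a block of length \<open>q\<close> at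
  \<open>i\<close>. In the last range \<open>k\<close> is the position that \<open>k + q - 1\<close>
  acquires once the block is contracted to one entry.\<close>

lemma sum_split_block:
  fixes \<psi> :: "nat \<Rightarrow> 'a::comm_monoid_add"
  assumes "i < p"
  shows "(\<Sum>k<p + q - 1. \<psi> k)
    = (\<Sum>k<i. \<psi> k) + (\<Sum>k<q. \<psi> (i + k)) + (\<Sum>k = i + 1..<p. \<psi> (k + q - 1))"
proof -
  have "{..<p + q - 1} = {..<i} \<union> ({i..<i + q} \<union> {i + q..<p + q - 1})"
    using assms by auto
  moreover have "(\<Sum>k\<in>{..<i} \<union> ({i..<i + q} \<union> {i + q..<p + q - 1}). \<psi> k) =
    (\<Sum>k<i. \<psi> k) + (\<Sum>k\<in>{i..<i + q} \<union> {i + q..<p + q - 1}. \<psi> k)"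
    by (rule sum.union_disjoint) auto
  moreover have "(\<Sum>k\<in>{i..<i + q} \<union> {i + q..<p + q - 1}. \<psi> k) =
    (\<Sum>k = i..<i + q. \<psi> k) + (\<Sum>k = i + q..<p + q - 1. \<psi> k)"
    by (rule sum.union_disjoint) auto
  ultimately have "(\<Sum>k<p + q - 1. \<psi> k) =
    (\<Sum>k<i. \<psi> k) + ((\<Sum>k = i..<i + q. \<psi> k) + (\<Sum>k = i + q..<p + q - 1. \<psi> k))"
    by (simp only:)
  also have "(\<Sum>k = i..<i + q. \<psi> k) = (\<Sum>k<q. \<psi> (i + k))"
    by (rule sum.reindex_bij_witness[of _ "\<lambda>k. i + k" "\<lambda>k. k - i"]) auto
  also have "(\<Sum>k = i + q..<p + q - 1. \<psi> k) = (\<Sum>k = i + 1..<p. \<psi> (k + q - 1))"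
    by (rule sum.reindex_bij_witness[of _ "\<lambda>k. k + q - 1" "\<lambda>k. k + 1 - q"]) auto
  finally show ?thesis
    by (simp add: ac_simps)
qed

text \<open>
  The cocycle condition of \<open>g\<close> inside the slot \<open>i\<close> of \<open>f\<close> trades products within the block fed
  to \<open>g\<close> for products of \<open>g\<close> with the two neighbours of that block.
\<close>

lemma contract_cocycle:
  fixes f g :: "'a::complex_algebra_1 list \<Rightarrow> 'a"
  assumes f: "f \<in> bar_cochains p" and g: "g \<in> hochschild_cocycles q"
    and as: "length as = p + q" and i: "i < p"
  defines "X \<equiv> \<lambda>i k. f (contract 2 mult_pair k (contract q g i as))"
  shows "(\<Sum>k<q. (- 1) ^ (k + 1) * f (contract q g i (contract 2 mult_pair (i + k) as)))
    = - X (i + 1) i - (- 1) ^ (q + 1) * X i i"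
proof -
  define us where "us = take i as"
  define bs where "bs = take (q + 1) (drop i as)"
  define vs where "vs = drop (i + (q + 1)) as"
  have split: "as = us @ bs @ vs"
    unfolding us_def bs_def vs_def using as i by (intro list_split_at) simp
  have len: "length us = i" "length bs = q + 1" "length us + length vs + 1 = p"
    using as i by (simp_all add: us_def bs_def vs_def)
  note lin = bar_cochains_slot[OF f len(3)]
  have "hochschild_d q g bs = 0"
    using g by (rule hochschild_cocyclesD)
  then have "0 = f (us @ hochschild_d q g bs # vs)"
    using clinear_zero[OF lin] by simp
  also have "\<dots> = f (us @ (hd bs * g (tl bs)) # vs)
      + (\<Sum>k<q. (- 1) ^ (k + 1) * f (us @ g (contract 2 mult_pair k bs) # vs))
      + (- 1) ^ (q + 1) * f (us @ (g (butlast bs) * last bs) # vs)"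
    unfolding hochschild_d_eq[OF len(2)]
    by (simp only: clinear_add[OF lin] clinear_sum[OF lin] clinear_sign[OF lin])
  also have "f (us @ (hd bs * g (tl bs)) # vs) = X (i + 1) i"
  proof -
    obtain x cs where x: "bs = x # cs"
      using len by (cases bs) auto
    then have "contract q g (i + 1) as = us @ [x, g cs] @ vs"
      using contract_append[of "us @ [x]" "i + 1" cs q g vs] split len by simp
    then show ?thesis
      using x len by (simp add: X_def contract_append mult_pair_def del: append_Cons append_Nil)
  qed
  also have "f (us @ (g (butlast bs) * last bs) # vs) = X i i"
  proof -
    obtain x cs where x: "bs = cs @ [x]"
      using len by (cases bs rule: rev_cases) auto
    then have "contract q g i as = us @ [g cs, x] @ vs"
      using contract_append[of us i cs q g "x # vs"] split len by simp
    then show ?thesis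
      using x len by (simp add: X_def contract_append mult_pair_def del: append_Cons append_Nil)
  qed
  also have "(\<Sum>k<q. (- 1) ^ (k + 1) * f (us @ g (contract 2 mult_pair k bs) # vs)) =
      (\<Sum>k<q. (- 1) ^ (k + 1) * f (contract q g i (contract 2 mult_pair (i + k) as)))"
  proof (intro sum.cong refl arg_cong[where f = "\<lambda>x. (- 1) ^ _ * f x"])
    fix k assume "k \<in> {..<q}"
    then have "contract q g i (contract 2 mult_pair (i + k) as) =
      take i as @ g (contract 2 mult_pair (i + k - i) (take (q + 2 - 1) (drop i as))) #
        drop (i + q + 2 - 1) as"
      using as i by (intro contract_contract_nested) auto
    then show "us @ g (contract 2 mult_pair k bs) # vs =
        contract q g i (contract 2 mult_pair (i + k) as)"
      by (simp add: us_def bs_def vs_def)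
  qed
  finally show ?thesis
    by (simp add: algebra_simps eq_neg_iff_add_eq_0 minus_equation_iff)
qed

text \<open>Gerstenhaber's homotopy formula for the commutator of the cup product.\<close>

lemma circle_product_hochschild_d:
  fixes f g :: "'a::complex_algebra_1 list \<Rightarrow> 'a"
  assumes f: "f \<in> bar_cochains p" and g: "g \<in> hochschild_cocycles q" and as: "length as = p + q"
  shows "circle_product (p + 1) q (hochschild_d p f) g as =
    (- 1) ^ (q + 1) * hochschild_d (p + q - 1) (circle_product p q f g) as
    + g (take q as) * f (drop q as) - (- 1) ^ (p * q) * (f (take p as) * g (drop p as))"
\<comment> \<open>For \<open>p > 0\<close> the degree \<open>p + q - 1\<close> is a true difference,
  so the last term of the differential has the sign \<open>(- 1) ^ (p + q)\<close>. For
  \<open>p = 0\<close> the circle product of \<open>f\<close> and \<open>g\<close> is zero and only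
  the commutator with \<open>f []\<close> remains.\<close>
proof (cases "p = 0")
  case True
  have "circle_product 1 q (hochschild_d 0 f) g as = g as * f [] - f [] * g as"
    using as True by (simp add: circle_product_eq contract_def hochschild_d_eq)
  moreover have "hochschild_d m (circle_product 0 q f g) as = 0" for m
    by (simp add: hochschild_d_def)
  ultimately show ?thesis
    using True as by simp
next
  case False
  define C where "C = contract q g"
  define M :: "nat \<Rightarrow> 'a list \<Rightarrow> 'a list" where "M = contract 2 mult_pair"
  define \<sigma> :: "nat \<Rightarrow> 'a" where "\<sigma> i = (- 1) ^ ((q + 1) * i)" for i
  define s :: 'a where "s = (- 1) ^ (q + 1)"
  define X where "X i k = f (M k (C i as))" for i k
  \<comment> \<open>Moving \<open>g\<close> one slot to the right costs the sign \<open>s\<close>,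
    whose square is 1.\<close>
  have s: "s * (s * x) = x" and \<sigma>_Suc: "\<sigma> (i + 1) * x = s * (\<sigma> i * x)" for x i
    by (cases "even q"; cases "even i"; simp add: s_def \<sigma>_def)+
  have len_C: "length (C i as) = p + 1" if "i \<le> p" for i
    using that as by (simp add: C_def length_contract)
  have d: "hochschild_d (p + q - 1) (circle_product p q f g) as =
      (\<Sum>i<p. \<sigma> i * (hd as * f (C i (tl as))))
      + (\<Sum>i<p. \<Sum>k<p + q - 1. \<sigma> i * ((- 1) ^ (k + 1) * f (C i (M k as))))
      + (\<Sum>i<p. \<sigma> i * ((- 1) ^ (p + q) * (f (C i (butlast as)) * last as)))"
  proof -
    have circle: "circle_product p q f g bs = (\<Sum>i<p. \<sigma> i * f (C i bs))"
      if "length bs + 1 = p + q" for bs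
      using that by (simp add: circle_product_eq \<sigma>_def C_def)
    have "length (M k as) + 1 = p + q" if "k < p + q - 1" for k
      using that as by (simp add: M_def length_contract)
    then have "hochschild_d (p + q - 1) (circle_product p q f g) as =
        hd as * (\<Sum>i<p. \<sigma> i * f (C i (tl as)))
        + (\<Sum>k<p + q - 1. (- 1) ^ (k + 1) * (\<Sum>i<p. \<sigma> i * f (C i (M k as))))
        + (- 1) ^ (p + q) * ((\<Sum>i<p. \<sigma> i * f (C i (butlast as))) * last as)"
      using as False by (simp add: hochschild_d_eq circle M_def[symmetric])
    moreover have "(\<Sum>k<p + q - 1. (- 1) ^ (k + 1) * (\<Sum>i<p. \<sigma> i * f (C i (M k as)))) =
        (\<Sum>i<p. \<Sum>k<p + q - 1. \<sigma> i * ((- 1) ^ (k + 1) * f (C i (M k as))))"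
      unfolding sum_distrib_left \<sigma>_def minus_one_power_left_commute[of "(- 1) ^ (_ + 1)"]
      by (rule sum.swap)
    moreover have "hd as * (\<Sum>i<p. \<sigma> i * f (C i (tl as))) =
        (\<Sum>i<p. \<sigma> i * (hd as * f (C i (tl as))))"
      unfolding sum_distrib_left \<sigma>_def minus_one_power_left_commute ..
    moreover have "(- 1) ^ (p + q) * ((\<Sum>i<p. \<sigma> i * f (C i (butlast as))) * last as) =
        (\<Sum>i<p. \<sigma> i * ((- 1) ^ (p + q) * (f (C i (butlast as)) * last as)))"
      unfolding sum_distrib_left sum_distrib_right \<sigma>_def mult.assoc
      by (simp only: minus_one_power_left_commute[of "(- 1) ^ (p + q)"])
    ultimately show ?thesis
      by (simp only:)
  qed
  have "circle_product (p + 1) q (hochschild_d p f) g as =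
     (\<Sum>i<p + 1. \<sigma> i * (hd (C i as) * f (tl (C i as))))
   + (\<Sum>i<p + 1. \<Sum>k<p. \<sigma> i * ((- 1) ^ (k + 1) * X i k))
   + (\<Sum>i<p + 1. \<sigma> i * ((- 1) ^ (p + 1) * (f (butlast (C i as)) * last (C i as))))"
  proof -
    have "circle_product (p + 1) q (hochschild_d p f) g as =
        (\<Sum>i<p + 1. \<sigma> i * hochschild_d p f (C i as))"
      using circle_product_eq[of as "p + 1" q] as by (simp add: \<sigma>_def C_def)
    also have "\<dots> = (\<Sum>i<p + 1. \<sigma> i * (hd (C i as) * f (tl (C i as)))
        + (\<Sum>k<p. \<sigma> i * ((- 1) ^ (k + 1) * X i k))
        + \<sigma> i * ((- 1) ^ (p + 1) * (f (butlast (C i as)) * last (C i as))))"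
      by (intro sum.cong refl)
        (simp only: lessThan_iff hochschild_d_eq len_C less_Suc_eq_le Suc_eq_plus1[symmetric]
          X_def M_def distrib_left sum_distrib_left)
    finally show ?thesis
      by (simp only: sum.distrib)
  qed
  \<comment> \<open>In slot 0 the value of \<open>g\<close> becomes the outer left factor, which
    gives one cup product; slot \<open>i + 1\<close> acts on the tail as slot
    \<open>i\<close>.\<close>
  also have "(\<Sum>i<p + 1. \<sigma> i * (hd (C i as) * f (tl (C i as)))) =
      g (take q as) * f (drop q as) + s * (\<Sum>i<p. \<sigma> i * (hd as * f (C i (tl as))))"
  proof -
    have "\<sigma> (i + 1) * (hd (C (i + 1) as) * f (tl (C (i + 1) as))) = s * (\<sigma> i * (hd as * f (C i (tl as))))"
      if "i < p" for i
      using as that unfolding \<sigma>_Suc by (cases as) (auto simp: C_def contract_def)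
    moreover have "\<sigma> 0 * (hd (C 0 as) * f (tl (C 0 as))) = g (take q as) * f (drop q as)"
      by (simp add: \<sigma>_def C_def contract_def)
    ultimately show ?thesis
      by (simp add: sum.lessThan_Suc_shift sum_distrib_left del: sum.lessThan_Suc)
  qed
  \<comment> \<open>Symmetrically, slot \<open>p\<close> gives the other cup product and the earlier
    slots act on \<open>butlast as\<close>.\<close>
  also have "(\<Sum>i<p + 1. \<sigma> i * ((- 1) ^ (p + 1) * (f (butlast (C i as)) * last (C i as)))) =
      s * (\<Sum>i<p. \<sigma> i * ((- 1) ^ (p + q) * (f (C i (butlast as)) * last as)))
      - (- 1) ^ (p * q) * (f (take p as) * g (drop p as))"
  proof -
    have "\<sigma> i * ((- 1) ^ (p + 1) * (f (butlast (C i as)) * last (C i as)))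
      = s * (\<sigma> i * ((- 1) ^ (p + q) * (f (C i (butlast as)) * last as)))" if "i < p" for i
    proof -
      have as': "as = butlast as @ [last as]"
        using that as by (cases as) auto
      have "C i as = C i (butlast as) @ [last as]"
        using that as by (subst as') (auto simp: C_def contract_def)
      then show ?thesis
        by (cases "even q"; cases "even p") (simp_all add: s_def)
    qed
    moreover have "\<sigma> p * ((- 1) ^ (p + 1) * (f (butlast (C p as)) * last (C p as)))
      = - ((- 1) ^ (p * q) * (f (take p as) * g (drop p as)))"
      using as by (cases "even q"; cases "even p")
        (simp_all add: \<sigma>_def C_def contract_def butlast_append)
    ultimately show ?thesis
      by (simp add: sum_distrib_left)
  qed
  also have "(\<Sum>i<p + 1. \<Sum>k<p. \<sigma> i * ((- 1) ^ (k + 1) * X i k)) =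
      s * (\<Sum>i<p. \<Sum>k<p + q - 1. \<sigma> i * ((- 1) ^ (k + 1) * f (C i (M k as))))"
  proof -
    have "(\<Sum>k<i. \<sigma> (i + 1) * ((- 1) ^ (k + 1) * X (i + 1) k))
        + \<sigma> (i + 1) * ((- 1) ^ (i + 1) * X (i + 1) i) + \<sigma> i * ((- 1) ^ (i + 1) * X i i)
        + (\<Sum>k = i + 1..<p. \<sigma> i * ((- 1) ^ (k + 1) * X i k))
      = s * (\<Sum>k<p + q - 1. \<sigma> i * ((- 1) ^ (k + 1) * f (C i (M k as))))" (is "?l = _")
      if "i < p" for i
    proof -
      \<comment> \<open>A product left of the block shortens the list in front of it, so slot
        \<open>i\<close> after the product is slot \<open>i + 1\<close> before it.\<close>
      have 1: "s * (\<Sum>k<i. \<sigma> i * ((- 1) ^ (k + 1) * f (C i (M k as)))) =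
          (\<Sum>k<i. \<sigma> (i + 1) * ((- 1) ^ (k + 1) * X (i + 1) k))"
        unfolding sum_distrib_left \<sigma>_Suc
      proof (intro sum.cong refl arg_cong[where f = "\<lambda>x. s * (_ * (_ * x))"])
        fix k assume "k \<in> {..<i}"
        then have "M k (C (i + 1) as) = C (i + 1 + 1 - 2) (M k as)"
          unfolding M_def C_def using as that by (intro contract_contract_disjoint) auto
        then show "f (C i (M k as)) = X (i + 1) k"
          by (simp add: X_def)
      qed
      have 2: "s * (\<Sum>k<q. \<sigma> i * ((- 1) ^ (i + k + 1) * f (C i (M (i + k) as)))) =
          \<sigma> (i + 1) * ((- 1) ^ (i + 1) * X (i + 1) i) + \<sigma> i * ((- 1) ^ (i + 1) * X i i)"
      proof -
        have "(\<Sum>k<q. \<sigma> i * ((- 1) ^ (i + k + 1) * f (C i (M (i + k) as)))) =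
          \<sigma> i * ((- 1) ^ i * (\<Sum>k<q. (- 1) ^ (k + 1) * f (C i (M (i + k) as))))"
          unfolding sum_distrib_left by (simp add: power_add mult.assoc)
        also have "\<dots> = \<sigma> i * ((- 1) ^ i * (- X (i + 1) i - s * X i i))"
          unfolding C_def M_def X_def s_def using contract_cocycle[OF f g as that] by simp
        finally have middle: "(\<Sum>k<q. \<sigma> i * ((- 1) ^ (i + k + 1) * f (C i (M (i + k) as)))) =
          \<sigma> i * ((- 1) ^ i * (- X (i + 1) i - s * X i i))" .
        show ?thesis
          unfolding middle \<sigma>_Suc
          by (cases "even q"; cases "even i") (simp_all add: s_def \<sigma>_def algebra_simps)
      qed
      \<comment> \<open>A product right of the block moves from \<open>k + q - 1\<close> to
        \<open>k\<close> when the block shrinks to one entry.\<close>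
      have 3: "s * (\<Sum>k = i + 1..<p. \<sigma> i * ((- 1) ^ (k + q - 1 + 1) * f (C i (M (k + q - 1) as)))) =
          (\<Sum>k = i + 1..<p. \<sigma> i * ((- 1) ^ (k + 1) * X i k))"
        unfolding sum_distrib_left
      proof (intro sum.cong refl)
        fix k assume k: "k \<in> {i + 1..<p}"
        then have "C i (M (k + q - 1) as) = M (k + q - 1 + 1 - q) (C i as)"
          unfolding M_def C_def using as that by (intro contract_contract_disjoint) auto
        then have "f (C i (M (k + q - 1) as)) = X i k"
          using k by (simp add: X_def)
        moreover have "k + q - 1 + 1 = k + q"
          using k by simp
        ultimately show "s * (\<sigma> i * ((- 1) ^ (k + q - 1 + 1) * f (C i (M (k + q - 1) as)))) =
            \<sigma> i * ((- 1) ^ (k + 1) * X i k)"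
          by (cases "even q"; cases "even k") (simp_all add: s_def)
      qed
      show ?thesis
        unfolding sum_split_block[OF that] distrib_left 1 2 3 by (simp only: ac_simps)
    qed
    then show ?thesis
      unfolding sum_split_adjacent sum_distrib_left[of s] by (intro sum.cong) simp_all
  qed
  finally show ?thesis
    unfolding d s_def distrib_left by (simp only: ac_simps diff_add_eq add_diff_eq)
qed

section \<open>Brackets of cocycles\<close>

lemma circle_product_zero:
  "(\<And>as. f as = 0) \<Longrightarrow> circle_product p q f g as = 0"
  by (simp add: circle_product_def scaleC_zero_right)

lemma bar_cochains_diff:
  fixes f g :: "'a::complex_algebra_1 list \<Rightarrow> 'a"
  assumes "f \<in> bar_cochains p" "g \<in> bar_cochains p"
  shows "(\<lambda>as. f as - (- 1) ^ n * g as) \<in> bar_cochains p"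
proof (rule bar_cochainsI)
  show "f as - (- 1) ^ n * g as = 0" if "length as \<noteq> p" for as
    using assms[THEN bar_cochains_outside, OF that] by simp
  show "clinear (\<lambda>a. f (us @ a # vs) - (- 1) ^ n * g (us @ a # vs))"
    if "length us + length vs + 1 = p" for us vs
    by (intro clinear_diff_fun clinear_mult_left assms[THEN bar_cochains_slot] that)
qed

lemma circle_product_bar_cochains:
  fixes f g :: "'a::complex_algebra_1 list \<Rightarrow> 'a"
  assumes f: "f \<in> bar_cochains p" and g: "g \<in> bar_cochains q"
  shows "circle_product p q f g \<in> bar_cochains (p + q - 1)"
proof (rule bar_cochainsI)
  fix as :: "'a list"
  assume "length as \<noteq> p + q - 1"
  then show "circle_product p q f g as = 0"
    by (intro circle_product_outside) auto
next
  fix us vs :: "'a list"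
  assume len: "length us + length vs + 1 = p + q - 1"
  have "clinear (\<lambda>a. f (contract q g i (us @ a # vs)))" if "i < p" for i
  proof -
    \<comment> \<open>The varied entry lies left of the block, inside it or right of it. Inside,
      linearity of \<open>g\<close> in a slot is composed with that of \<open>f\<close>.\<close>
    consider "length us < i" | "i \<le> length us" "length us < i + q" | "i + q \<le> length us"
      by linarith
    then show ?thesis
    proof cases
      case 1
      then have "contract q g i (us @ a # vs) = us @ a # contract q g (i - length us - 1) vs" for a
        by (simp add: contract_def take_Cons' drop_Cons')
      moreover have "length us + length (contract q g (i - length us - 1) vs) + 1 = p"
        using 1 that len by (subst length_contract) auto
      ultimately show ?thesis
        using bar_cochains_slot[OF f] by simp
    next
      case 2
      then have "contract q g i (us @ a # vs) = take i us @
          g (drop i us @ a # take (q + i - length us - 1) vs) # drop (i + q - length us - 1) vs" for a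
        by (simp add: contract_def take_Cons' drop_Cons')
      moreover have "clinear (\<lambda>a. g (drop i us @ a # take (q + i - length us - 1) vs))"
        using 2 that len by (intro bar_cochains_slot[OF g]) auto
      moreover have "clinear (\<lambda>b. f (take i us @ b # drop (i + q - length us - 1) vs))"
        using 2 that len by (intro bar_cochains_slot[OF f]) auto
      ultimately show ?thesis
        using clinear_compose by simp
    next
      case 3
      then have "contract q g i (us @ a # vs) = contract q g i us @ a # vs" for a
        by (simp add: contract_def)
      moreover have "length (contract q g i us) + length vs + 1 = p"
        using 3 that len by (subst length_contract) auto
      ultimately show ?thesis
        using bar_cochains_slot[OF f] by simp
    qed
  qed
  moreover have "circle_product p q f g (us @ a # vs) =
      (\<Sum>i<p. (- 1) ^ ((q + 1) * i) * f (contract q g i (us @ a # vs)))" for a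
    using len by (intro circle_product_eq) simp
  ultimately show "clinear (\<lambda>a. circle_product p q f g (us @ a # vs))"
    by (simp only:) (intro clinear_sum_fun clinear_mult_left, simp)
qed

lemma hochschild_d_diff:
  "hochschild_d p (\<lambda>as. f as - (- 1) ^ n * g as) as
    = hochschild_d p f as - (- 1) ^ n * hochschild_d p g as"
proof (cases "length as = p + 1")
  case True
  have 1: "x * (y - (- 1) ^ n * z) = x * y - (- 1) ^ n * (x * z)"
    "(y - (- 1) ^ n * z) * x = y * x - (- 1) ^ n * (z * x)" for x y z :: 'a
    by (cases "even n"; simp add: algebra_simps)+
  show ?thesis
    unfolding hochschild_d_eq[OF True] 1 sum_subtractf distrib_left sum_distrib_left by simp
qed (simp add: hochschild_d_def)

text \<open>As \<open>f\<close> is a cocycle as well, the left side of Gerstenhaber's formula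
  vanishes, which leaves a graded commutator of cup products. Exchanging \<open>f\<close> and
  \<open>g\<close> reproduces it up to sign, so the two contributions cancel in the bracket.\<close>

lemma hochschild_d_circle_product:
  fixes f g :: "'a::complex_algebra_1 list \<Rightarrow> 'a"
  assumes f: "f \<in> hochschild_cocycles p" and g: "g \<in> hochschild_cocycles q"
    and as: "length as = p + q"
  shows "hochschild_d (p + q - 1) (circle_product p q f g) as
    = (- 1) ^ q * (g (take q as) * f (drop q as)
      - (- 1) ^ (p * q) * (f (take p as) * g (drop p as)))"
proof -
  have "hochschild_d p f = (\<lambda>_. 0)"
    using f by (simp add: hochschild_cocycles_def)
  then have "circle_product (p + 1) q (hochschild_d p f) g as = 0"
    by (simp add: circle_product_def scaleC_zero_right)
  then show ?thesis
    using circle_product_hochschild_d[OF hochschild_cocyclesD(1)[OF f] g as]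
    by (cases "even q") (simp_all add: algebra_simps eq_neg_iff_add_eq_0)
qed

lemma gerstenhaber_eq:
  "gerstenhaber p q f g as
    = circle_product p q f g as - (- 1) ^ ((p + 1) * (q + 1)) * circle_product q p g f as"
  unfolding gerstenhaber_def
  by (subst scaleC_minus_one_powi[where n = "(p + 1) * (q + 1)"]) (simp_all add: algebra_simps)

lemma gerstenhaber_cocycle:
  fixes f g :: "'a::complex_algebra_1 list \<Rightarrow> 'a"
  assumes f: "f \<in> hochschild_cocycles p" and g: "g \<in> hochschild_cocycles q"
  shows "gerstenhaber p q f g \<in> hochschild_cocycles (p + q - 1)"
proof -
  have eq: "gerstenhaber p q f g = (\<lambda>as. circle_product p q f g as
      - (- 1) ^ ((p + 1) * (q + 1)) * circle_product q p g f as)"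
    by (rule ext) (rule gerstenhaber_eq)
  have "hochschild_d (p + q - 1) (gerstenhaber p q f g) as = 0" for as
  proof (cases "length as = p + q")
    case True
    then show ?thesis
      using hochschild_d_circle_product[OF f g, of as] hochschild_d_circle_product[OF g f, of as]
      unfolding eq hochschild_d_diff
      by (cases "even p"; cases "even q") (simp_all add: add.commute[of q p])
  next
    \<comment> \<open>The differential vanishes on lists of the wrong length, except that for
      \<open>p = q = 0\<close> the degree truncates to 0 and lists of length 1 count as right; there
      the bracket itself is zero.\<close>
    case False
    then show ?thesis
      using gerstenhaber_eq[of 0 0 f g]
      by (cases "p = 0 \<and> q = 0") (auto simp: hochschild_d_def)
  qed
  moreover have "gerstenhaber p q f g \<in> bar_cochains (p + q - 1)"
    unfolding eq using f g circle_product_bar_cochains[of g q f p]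
    by (intro bar_cochains_diff circle_product_bar_cochains)
      (auto simp: hochschild_cocycles_def add.commute)
  ultimately show ?thesis
    by (simp add: hochschild_cocycles_def fun_eq_iff)
qed

section \<open>Circle products with elements of the algebra\<close>

definition cochain0 :: "'a::zero \<Rightarrow> 'a list \<Rightarrow> 'a"
  where "cochain0 x as = (if as = [] then x else 0)"

text \<open>The composition \<open>f \<circ> x\<close>: \<open>x\<close> is inserted at every
  position with alternating signs. For \<open>x\<close> from \<open>V\<close> it becomes the
  contraction of a polyvector field with a vector.\<close>

abbreviation insertion :: "nat \<Rightarrow> 'a::complex_algebra_1 \<Rightarrow> ('a list \<Rightarrow> 'a) \<Rightarrow> 'a list \<Rightarrow> 'a"
  where "insertion p x f \<equiv> circle_product p 0 f (cochain0 x)"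

lemma cochain0_bar_cochains: "cochain0 x \<in> bar_cochains 0"
  by (simp add: bar_cochains_def cochain0_def)

lemma cochain0_cocycle:
  fixes x :: "'a::{complex_algebra_1, comm_ring_1}"
  shows "cochain0 x \<in> hochschild_cocycles 0"
  unfolding hochschild_cocycles_def
proof (safe, fact cochain0_bar_cochains)
  have "hochschild_d 0 (cochain0 x) as = 0" for as
    by (cases "length as = 0 + 1")
      (auto simp: hochschild_d_eq hochschild_d_def cochain0_def length_Suc_conv)
  then show "hochschild_d 0 (cochain0 x) = (\<lambda>_. 0)"
    by (rule ext)
qed

text \<open>Gerstenhaber's formula with \<open>q = 0\<close>: the two cup products are
  \<open>x\<close> times \<open>f as\<close> in either order and cancel by commutativity.\<close>

lemma insertion_hochschild_d:
  fixes f :: "'a::{complex_algebra_1, comm_ring_1} list \<Rightarrow> 'a"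
  assumes "f \<in> bar_cochains p" "0 < p"
  shows "insertion (p + 1) x (hochschild_d p f) as = - hochschild_d (p - 1) (insertion p x f) as"
proof (cases "length as = p")
  case True
  then show ?thesis
    using circle_product_hochschild_d[OF assms(1) cochain0_cocycle, of as x]
    by (simp add: cochain0_def mult.commute)
next
  case False
  then show ?thesis
    using assms(2) by (simp add: hochschild_d_def circle_product_outside)
qed

lemma insertion_cocycle:
  fixes f :: "'a::{complex_algebra_1, comm_ring_1} list \<Rightarrow> 'a"
  assumes "f \<in> hochschild_cocycles p"
  shows "insertion p x f \<in> hochschild_cocycles (p - 1)"
proof -
  have "hochschild_d (p - 1) (insertion p x f) as = 0" for as
  proof (cases "p = 0")
    case False
    have "hochschild_d p f = (\<lambda>_. 0)"
      using assms by (simp add: hochschild_cocycles_def)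
    then have "insertion (p + 1) x (hochschild_d p f) as = 0"
      by (simp add: circle_product_def scaleC_zero_right)
    then show ?thesis
      using insertion_hochschild_d[OF hochschild_cocyclesD(1)[OF assms], of x as] False by simp
  qed (simp add: hochschild_d_def)
  then show ?thesis
    using circle_product_bar_cochains[OF hochschild_cocyclesD(1)[OF assms] cochain0_bar_cochains, of x]
    by (simp add: hochschild_cocycles_def fun_eq_iff)
qed

text \<open>
  The pre-Lie identity with a third argument of degree \<open>0\<close>: the remaining term of the identity
  composes an element of the algebra with \<open>g\<close> and vanishes.
\<close>

lemma insertion_circle_product:
  fixes f g :: "'a::complex_algebra_1 list \<Rightarrow> 'a"
  assumes f: "f \<in> bar_cochains p"
  shows "insertion (p + q - 1) x (circle_product p q f g) as =
    circle_product p (q - 1) f (insertion q x g) as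
    + (- 1) ^ (q + 1) * circle_product (p - 1) q (insertion p x f) g as"
proof (cases "0 < p \<and> length as + 2 = p + q")
  case False
  \<comment> \<open>For \<open>q = 0\<close> the truncated \<open>q - 1\<close> is again 0, so the
    length alone does not exclude this term; it vanishes because \<open>f\<close> is linear and
    \<open>insertion 0 x g\<close> is zero.\<close>
  have "circle_product p 0 f (insertion 0 x g) as = 0"
  proof (cases "length as + 1 = p")
    case True
    have "f (take i as @ 0 # drop i as) = 0" if "i < p" for i
      using that True by (intro clinear_zero[OF bar_cochains_slot[OF f]]) simp
    then show ?thesis
      using True by (simp add: circle_product_eq contract_def)
  qed (simp add: circle_product_outside)
  moreover have "p = 0 \<or> length as + 1 \<noteq> p + q - 1"
    using False by auto
  ultimately show ?thesis
    using False
    by (cases "p = 0"; cases "q = 0")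
      (auto simp: circle_product_outside circle_product_zero)
next
  case True
  then obtain n where p: "p = Suc n"
    by (cases p) auto
  have as: "length as + 1 = n + q" "length as + 2 = p + q"
    using True p by auto
  define C where "C = contract q g"
  define I where "I = contract 0 (cochain0 x)"
  define \<sigma> :: "nat \<Rightarrow> 'a" where "\<sigma> i = (- 1) ^ ((q + 1) * i)" for i
  define s :: 'a where "s = (- 1) ^ (q + 1)"
  define Y where "Y i j = f (I j (C i as))" for i j
  have \<sigma>_Suc: "\<sigma> (Suc i) * x = s * (\<sigma> i * x)" for x i
    by (cases "even q"; cases "even i"; simp add: s_def \<sigma>_def)+
  have insert_eq: "insertion m x h bs = (\<Sum>j<m. (- 1) ^ j * h (I j bs))"
    if "length bs + 1 = m" for m h bs
    using that by (simp add: circle_product_eq I_def)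
  have circle_eq: "circle_product m q h g bs = (\<Sum>i<m. \<sigma> i * h (C i bs))"
    if "length bs + 1 = m + q" for m h bs
    using that by (simp add: circle_product_eq C_def \<sigma>_def)
  have len: "length (I j as) = length as + 1" if "j < p + q - 1" for j
    using that as by (simp add: I_def length_contract)
  have len': "length (C i as) + 1 = p" if "i < n" for i
    using that as p by (simp add: C_def length_contract)
  have "insertion (p + q - 1) x (circle_product p q f g) as =
      (\<Sum>j<p + q - 1. (- 1) ^ j * (\<Sum>i<p. \<sigma> i * f (C i (I j as))))"
    using as by (simp add: insert_eq circle_eq len)
  also have "\<dots> = (\<Sum>i<p. \<Sum>j<p + q - 1. \<sigma> i * ((- 1) ^ j * f (C i (I j as))))"
    unfolding sum_distrib_left \<sigma>_def minus_one_power_left_commute[of "(- 1) ^ (_ * _)"]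
    by (rule sum.swap)
  \<comment> \<open>\<open>x\<close> is inserted before, inside or after the block fed to
    \<open>g\<close>. Inside there are \<open>q\<close> places among \<open>q - 1\<close> old
    entries.\<close>
  also have "\<dots> = (\<Sum>i<p. (\<Sum>j<i. \<sigma> i * ((- 1) ^ j * Y (i - 1) j))
      + (\<Sum>j<q. \<sigma> i * ((- 1) ^ (i + j) * f (C i (I (i + j) as))))
      + (\<Sum>j = i + 1..<p. \<sigma> i * ((- 1) ^ (j + q - 1) * Y i j)))"
  proof (intro sum.cong refl)
    fix i assume "i \<in> {..<p}"
    then have i: "i < p"
      by simp
    have "C i (I j as) = I j (C (i - 1) as)" if "j < i" for j
      using that i as contract_contract_disjoint[of j 0 "i - 1" q as "cochain0 x" g]
      by (simp add: C_def I_def)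
    moreover have "C i (I (j + q - 1) as) = I j (C i as)" if "i + 1 \<le> j" "j < p" for j
      using that i as contract_contract_disjoint[of i q "j + q - 1" 0 as g "cochain0 x"]
      by (simp add: C_def I_def)
    ultimately show "(\<Sum>j<p + q - 1. \<sigma> i * ((- 1) ^ j * f (C i (I j as)))) =
      (\<Sum>j<i. \<sigma> i * ((- 1) ^ j * Y (i - 1) j))
      + (\<Sum>j<q. \<sigma> i * ((- 1) ^ (i + j) * f (C i (I (i + j) as))))
      + (\<Sum>j = i + 1..<p. \<sigma> i * ((- 1) ^ (j + q - 1) * Y i j))"
      unfolding sum_split_block[OF i] Y_def
      by (intro arg_cong2[where f = "(+)"] sum.cong refl) auto
  qed
  also have "\<dots> = (\<Sum>i<p. \<Sum>j<i. \<sigma> i * ((- 1) ^ j * Y (i - 1) j))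
      + (\<Sum>i<p. \<Sum>j<q. \<sigma> i * ((- 1) ^ (i + j) * f (C i (I (i + j) as))))
      + (\<Sum>i<p. \<Sum>j = i + 1..<p. \<sigma> i * ((- 1) ^ (j + q - 1) * Y i j))"
    by (simp only: sum.distrib)
  \<comment> \<open>No place precedes the block at 0, so the block index can be lowered by one, at
    the cost of the sign \<open>s\<close>.\<close>
  also have "(\<Sum>i<p. \<Sum>j<i. \<sigma> i * ((- 1) ^ j * Y (i - 1) j)) =
      s * (\<Sum>i<n. \<Sum>j<i + 1. \<sigma> i * ((- 1) ^ j * Y i j))"
    unfolding p sum.lessThan_Suc_shift[of _ n] sum_distrib_left \<sigma>_Suc by simp
  also have "(\<Sum>i<p. \<Sum>j = i + 1..<p. \<sigma> i * ((- 1) ^ (j + q - 1) * Y i j)) =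
      s * (\<Sum>i<n. \<Sum>j = i + 1..<p. \<sigma> i * ((- 1) ^ j * Y i j))"
  proof -
    have "\<sigma> i * ((- 1) ^ (j + q - 1) * y) = s * (\<sigma> i * ((- 1) ^ j * y))" if "i + 1 \<le> j" for i j y
      using that by (cases j; cases "even q"; cases "even (j - 1)") (simp_all add: s_def)
    then show ?thesis
      unfolding p sum_distrib_left by simp
  qed
  \<comment> \<open>The places inside the block assemble to \<open>f \<circ> (g \<circ> x)\<close>
    by linearity of \<open>f\<close> in the slot of the block.\<close>
  also have "(\<Sum>i<p. \<Sum>j<q. \<sigma> i * ((- 1) ^ (i + j) * f (C i (I (i + j) as)))) =
      circle_product p (q - 1) f (insertion q x g) as"
  proof (cases "q = 0")
    case True
    then have "length as + 1 \<noteq> p + (q - 1)"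
      using as by simp
    with True show ?thesis
      by (simp add: circle_product_outside)
  next
    case False
    have "(\<Sum>j<q. \<sigma> i * ((- 1) ^ (i + j) * f (C i (I (i + j) as)))) =
        (- 1) ^ (q * i) * f (contract (q - 1) (insertion q x g) i as)" if i: "i < p" for i
    proof -
      let ?bs = "take (q - 1) (drop i as)"
      let ?F = "\<lambda>y. f (take i as @ y # drop (i + q - 1) as)"
      have lin: "clinear ?F"
        using i as False by (intro bar_cochains_slot[OF f]) auto
      have "C i (I (i + j) as) = take i as @ g (I j ?bs) # drop (i + q - 1) as" if "j < q" for j
        using that i as contract_contract_nested[of i "i + j" q 0 as g "cochain0 x"]
        by (simp add: C_def I_def)
      then have "(\<Sum>j<q. \<sigma> i * ((- 1) ^ (i + j) * f (C i (I (i + j) as)))) =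
          (\<Sum>j<q. \<sigma> i * ((- 1) ^ i * ?F ((- 1) ^ j * g (I j ?bs))))"
        by (intro sum.cong) (simp_all add: clinear_sign[OF lin] power_add mult.assoc del: One_nat_def)
      also have "\<dots> = \<sigma> i * ((- 1) ^ i * ?F (insertion q x g ?bs))"
        using i as False by (simp add: insert_eq clinear_sum[OF lin] sum_distrib_left del: One_nat_def)
      also have "\<dots> = (- 1) ^ (q * i) * ?F (insertion q x g ?bs)"
        by (cases "even q"; cases "even i") (simp_all add: \<sigma>_def)
      finally show ?thesis
        using False by (simp add: contract_def)
    qed
    then show ?thesis
      using as False by (simp add: circle_product_eq)
  qed
  \<comment> \<open>The places before and after the block are together all \<open>p\<close> places
    in the contracted list, which gives \<open>(f \<circ> x) \<circ> g\<close>.\<close>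
  also have "s * (\<Sum>i<n. \<Sum>j<i + 1. \<sigma> i * ((- 1) ^ j * Y i j))
      + circle_product p (q - 1) f (insertion q x g) as
      + s * (\<Sum>i<n. \<Sum>j = i + 1..<p. \<sigma> i * ((- 1) ^ j * Y i j))
      = circle_product p (q - 1) f (insertion q x g) as
      + s * (\<Sum>i<n. \<Sum>j<p. \<sigma> i * ((- 1) ^ j * Y i j))"
  proof -
    have "(\<Sum>j<p. \<sigma> i * ((- 1) ^ j * Y i j)) = (\<Sum>j<i + 1. \<sigma> i * ((- 1) ^ j * Y i j))
      + (\<Sum>j = i + 1..<p. \<sigma> i * ((- 1) ^ j * Y i j))" if "i < n" for i
    proof -
      have "i < p"
        using that p by simp
      then show ?thesis
        by (subst sum.union_disjoint[symmetric]) (auto intro!: sum.cong simp del: sum.lessThan_Suc)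
    qed
    then show ?thesis
      by (simp add: sum.distrib distrib_left)
  qed
  also have "(\<Sum>i<n. \<Sum>j<p. \<sigma> i * ((- 1) ^ j * Y i j)) =
      circle_product (p - 1) q (insertion p x f) g as"
    using as len' p by (simp add: circle_eq insert_eq Y_def sum_distrib_left distrib_left)
  finally show ?thesis
    by (simp add: s_def)
qed

section \<open>Antisymmetrization\<close>

lemma antisymmetrize_cong:
  assumes "\<And>ys. length ys = p \<Longrightarrow> f (map sym_incl ys) = g (map sym_incl ys)"
  shows "antisymmetrize p f xs = antisymmetrize p g xs"
proof (cases "length xs = p")
  case True
  then show ?thesis
    unfolding antisymmetrize_def by (auto intro!: sum.cong simp: assms)
qed (simp add: antisymmetrize_def)

lemma antisymmetrize_0: "antisymmetrize 0 f xs = (if xs = [] then f [] else 0)"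
  by (simp add: antisymmetrize_def)

lemma antisymmetrize_zero: "antisymmetrize p (\<lambda>_. 0) xs = 0"
  by (simp add: antisymmetrize_def)

lemma antisymmetrize_add:
  "antisymmetrize p (\<lambda>as. f as + (- 1) ^ n * g as) xs
    = antisymmetrize p f xs + (- 1) ^ n * antisymmetrize p g xs"
  by (simp add: antisymmetrize_def distrib_left sum.distrib sum_distrib_left
      mult.left_commute[of "(- 1) ^ n"])

lemma antisymmetrize_diff:
  "antisymmetrize p (\<lambda>as. f as - (- 1) ^ n * g as) xs
    = antisymmetrize p f xs - (- 1) ^ n * antisymmetrize p g xs"
  using antisymmetrize_add[of p f "n + 1" g xs] by simp

lemma antisymmetrize_sum:
  "antisymmetrize p (\<lambda>as. \<Sum>i\<in>A. (- 1) ^ e i * f i as) xs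
    = (\<Sum>i\<in>A. (- 1) ^ e i * antisymmetrize p (f i) xs)"
proof (induction A rule: infinite_finite_induct)
  case (insert i A)
  then show ?case
    using antisymmetrize_add[of p "\<lambda>as. \<Sum>i\<in>A. (- 1) ^ e i * f i as" "e i" "f i" xs]
    by (simp add: add.commute)
qed (simp_all add: antisymmetrize_zero)

lemma insertion_eq:
  "length as + 1 = p \<Longrightarrow> insertion p x f as = (\<Sum>i<p. (- 1) ^ i * f (take i as @ x # drop i as))"
  by (simp add: circle_product_eq contract_def cochain0_def)

text \<open>\<open>permutation_insert i 0 \<sigma>\<close> sends \<open>i\<close> to 0, where the
  head \<open>x\<close> stands, and maps the other positions in order through
  \<open>\<sigma>\<close> to the nonzero ones.\<close>

lemma permute_list_permutation_insert:
  assumes "\<sigma> permutes {0..<length xs}" "i \<le> length xs"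
  shows "permute_list (permutation_insert i 0 \<sigma>) (x # xs)
    = take i (permute_list \<sigma> xs) @ x # drop i (permute_list \<sigma> xs)"
proof (rule nth_equalityI)
  fix k assume "k < length (permute_list (permutation_insert i 0 \<sigma>) (x # xs))"
  then show "permute_list (permutation_insert i 0 \<sigma>) (x # xs) ! k
    = (take i (permute_list \<sigma> xs) @ x # drop i (permute_list \<sigma> xs)) ! k"
    using assms(2)
    by (cases "k < i"; cases "k = i")
      (auto simp: permute_list_def permutation_insert_expand nth_append nth_Cons' simp del: upt_Suc)
qed (use assms(2) in simp)

text \<open>Expansion according to the position that a permutation gives to the head of the list.\<close>

lemma antisymmetrize_Cons:
  "antisymmetrize (Suc p) f (x # xs) = antisymmetrize p (insertion (Suc p) (sym_incl x) f) xs"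
proof (cases "length xs = p")
  case True
  define F where "F \<pi> = of_int (sign \<pi>) * f (map sym_incl (permute_list \<pi> (x # xs)))" for \<pi>
  let ?S = "{\<sigma>. \<sigma> permutes {0..<p}}"
  \<comment> \<open>The sign of \<open>permutation_insert i 0 \<sigma>\<close> is
    \<open>(- 1) ^ i\<close> times that of \<open>\<sigma>\<close>, and \<open>(- 1) ^ i\<close> is
    the sign with which \<open>insertion\<close> uses position \<open>i\<close>.\<close>
  have F_insert: "F (permutation_insert i 0 \<sigma>) = of_int (sign \<sigma>) * ((- 1) ^ i *
      f (take i (map sym_incl (permute_list \<sigma> xs)) @ sym_incl x # drop i (map sym_incl (permute_list \<sigma> xs))))"
    if "\<sigma> \<in> ?S" "i < Suc p" for i \<sigma>
    using that signof_permutation_insert[of \<sigma> p i 0, where 'a = "'a sym"] True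
    by (simp add: F_def permute_list_permutation_insert take_map drop_map)
  have "antisymmetrize (Suc p) f (x # xs) = sum F {\<pi>. \<pi> permutes {0..<Suc p}}"
    using True by (simp add: antisymmetrize_def F_def lessThan_atLeast0)
  also have "\<dots> = sum F (\<Union>i\<in>{0..<Suc p}. {\<pi>. \<pi> permutes {0..<Suc p} \<and> \<pi> i = 0})"
    by (subst permutation_split_ran[of 0]) simp_all
  also have "\<dots> = (\<Sum>i\<in>{0..<Suc p}. sum F {\<pi>. \<pi> permutes {0..<Suc p} \<and> \<pi> i = 0})"
    using permutation_disjoint_dom[of _ "{0..<Suc p}" _ 0] finite_permutations[of "{0..<Suc p}"]
    by (intro sum.UNION_disjoint) auto
  also have "\<dots> = (\<Sum>i\<in>{0..<Suc p}. \<Sum>\<sigma>\<in>?S. F (permutation_insert i 0 \<sigma>))"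
  proof (rule sum.cong[OF refl])
    fix i assume "i \<in> {0..<Suc p}"
    then show "sum F {\<pi>. \<pi> permutes {0..<Suc p} \<and> \<pi> i = 0} = (\<Sum>\<sigma>\<in>?S. F (permutation_insert i 0 \<sigma>))"
      by (subst permutation_fix, simp, simp, subst sum.reindex[OF permutation_insert_inj_on]) simp_all
  qed
  also have "\<dots> = (\<Sum>\<sigma>\<in>?S. \<Sum>i<Suc p. F (permutation_insert i 0 \<sigma>))"
    unfolding lessThan_atLeast0 by (rule sum.swap)
  also have "\<dots> = (\<Sum>\<sigma>\<in>?S. of_int (sign \<sigma>) *
      insertion (Suc p) (sym_incl x) f (map sym_incl (permute_list \<sigma> xs)))"
  proof (intro sum.cong refl)
    fix \<sigma> assume "\<sigma> \<in> ?S"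
    then show "(\<Sum>i<Suc p. F (permutation_insert i 0 \<sigma>)) =
        of_int (sign \<sigma>) * insertion (Suc p) (sym_incl x) f (map sym_incl (permute_list \<sigma> xs))"
      using True by (simp add: insertion_eq F_insert sum_distrib_left del: sum.lessThan_Suc)
  qed
  finally show ?thesis
    using True by (simp add: antisymmetrize_def lessThan_atLeast0)
qed (simp add: antisymmetrize_def)

lemma antisymmetrize_1: "antisymmetrize 1 f [u] = f [sym_incl u]"
  using antisymmetrize_Cons[of 0 f u "[]"] by (simp add: antisymmetrize_0 insertion_eq)

text \<open>Contraction with the head anticommutes with the differential and lowers the degree of
  \<open>f\<close>, until only a commutator in a commutative algebra is left.\<close>

lemma antisymmetrize_hochschild_d:
  "f \<in> bar_cochains p \<Longrightarrow> antisymmetrize (Suc p) (hochschild_d p f) xs = 0"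
proof (induction p arbitrary: f xs)
  case 0
  show ?case
  proof (cases "length xs = 1")
    case True
    then obtain x where "xs = [x]"
      by (auto simp: length_Suc_conv)
    then show ?thesis
      using antisymmetrize_1[of "hochschild_d 0 f" x] by (simp add: hochschild_d_eq mult.commute)
  qed (simp add: antisymmetrize_def)
next
  case (Suc p)
  show ?case
  proof (cases xs)
    case (Cons x ys)
    have "antisymmetrize (Suc (Suc p)) (hochschild_d (Suc p) f) xs =
        antisymmetrize (Suc p) (insertion (Suc (Suc p)) (sym_incl x) (hochschild_d (Suc p) f)) ys"
      by (simp add: Cons antisymmetrize_Cons)
    also have "\<dots> = antisymmetrize (Suc p) (\<lambda>as. 0 - (- 1) ^ 0 *
        hochschild_d p (insertion (Suc p) (sym_incl x) f) as) ys"
      using insertion_hochschild_d[OF Suc.prems, of "sym_incl x"]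
      by (intro antisymmetrize_cong) simp
    also have "\<dots> = 0"
      unfolding antisymmetrize_diff
      using Suc.IH[of "insertion (Suc p) (sym_incl x) f" ys]
        circle_product_bar_cochains[OF Suc.prems cochain0_bar_cochains]
      by (simp add: antisymmetrize_zero)
    finally show ?thesis .
  qed (simp add: antisymmetrize_def)
qed

section \<open>Derivations of the symmetric algebra\<close>

lemma poly_mapping_add_induct [case_names zero add]:
  fixes f :: "'k \<Rightarrow>\<^sub>0 'b::monoid_add"
  assumes "P 0" "\<And>f k b. P f \<Longrightarrow> P (f + Poly_Mapping.single k b)"
  shows "P f"
proof (induction f rule: update_induct)
  case (update f k b)
  have "Poly_Mapping.update k b f = f + Poly_Mapping.single k b"
    using update(1)
    by (intro poly_mapping_eqI)
      (auto simp: lookup_update lookup_add lookup_single when_def in_keys_iff)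
  with update assms(2) show ?case
    by simp
qed (fact assms(1))

text \<open>\<open>S(V)\<close> is a quotient of a polynomial ring, and polynomials arise from
  scalars and variables by products and sums.\<close>

lemma sym_induct [case_names scalar incl add mult]:
  assumes scalar: "\<And>c. P (c *\<^sub>C 1)" and incl: "\<And>u. P (sym_incl u)"
    and add: "\<And>a b. P a \<Longrightarrow> P b \<Longrightarrow> P (a + b)" and mult: "\<And>a b. P a \<Longrightarrow> P b \<Longrightarrow> P (a * b)"
  shows "P s"
proof -
  have one: "P 1"
    using scalar[of 1] by (simp add: scaleC_one)
  have monomial: "P (abs_sym (Poly_Mapping.single m 1))" for m
  proof (induction m rule: poly_mapping_add_induct)
    case zero
    then show ?case
      using one by (simp add: one_sym_def)
  next
    case (add m u k)
    have "P (abs_sym (Poly_Mapping.single (Poly_Mapping.single u k) 1))"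
    proof (induction k)
      case 0
      then show ?case
        using one by (simp add: one_sym_def)
    next
      case (Suc k)
      have "Poly_Mapping.single (Poly_Mapping.single u (Suc k)) (1 :: complex) =
          free_var u * Poly_Mapping.single (Poly_Mapping.single u k) 1"
        by (simp add: free_var_def mult_single single_add[symmetric])
      then show ?case
        using mult[OF incl Suc] by (simp add: times_sym.abs_eq sym_incl.abs_eq sym_incl_def)
    qed
    from mult[OF add this] show ?case
      by (simp add: times_sym.abs_eq mult_single)
  qed
  have "P (abs_sym a)" for a
  proof (induction a rule: poly_mapping_add_induct)
    case zero
    have "P (0 *\<^sub>C 1)"
      by (rule scalar)
    also have "0 *\<^sub>C 1 = abs_sym (0 :: 'a free_calg)"
      by (simp add: one_sym_def scaleC_sym.abs_eq free_const_def)
    finally show ?case .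
  next
    case (add a m c)
    have "abs_sym (Poly_Mapping.single m c) = c *\<^sub>C 1 * abs_sym (Poly_Mapping.single m 1)"
      by (simp add: one_sym_def scaleC_sym.abs_eq times_sym.abs_eq free_const_def mult_single)
    with mult[OF scalar monomial, of c m] have "P (abs_sym (Poly_Mapping.single m c))"
      by simp
    from assms(3)[OF add this] show ?case
      by (simp add: plus_sym.abs_eq)
  qed
  then show ?thesis
    by (metis Quotient3_abs_rep Quotient3_sym)
qed

definition derivation :: "('a::complex_algebra_1 \<Rightarrow> 'a) \<Rightarrow> bool"
  where "derivation D \<longleftrightarrow> clinear D \<and> (\<forall>a b. D (a * b) = D a * b + a * D b)"

lemma derivation_one: "derivation D \<Longrightarrow> D 1 = 0"
  unfolding derivation_def by (metis add_cancel_right_right mult_1 mult_1_right)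

lemma derivation_scalar: "derivation D \<Longrightarrow> D (c *\<^sub>C 1) = 0"
  using derivation_one[of D] by (simp add: derivation_def clinear_scale scaleC_zero_right)

lemma derivation_sym_eqI:
  assumes "derivation D" "derivation D'" "\<And>u. D (sym_incl u) = D' (sym_incl u)"
  shows "D s = D' s"
  using assms(1,2)
  by (induction s rule: sym_induct)
    (auto simp: derivation_scalar assms(3), auto simp: derivation_def clinear_add)

section \<open>Antisymmetrized circle products\<close>

lemma cocycle_1_derivation:
  assumes "f \<in> hochschild_cocycles 1"
  shows "derivation (\<lambda>a. f [a])"
  unfolding derivation_def
proof (intro conjI allI)
  show "clinear (\<lambda>a. f [a])"
    using bar_cochains_slot[OF hochschild_cocyclesD(1)[OF assms], of "[]" "[]"] by simp
  show "f [a * b] = f [a] * b + a * f [b]" for a b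
    using hochschild_cocyclesD(2)[OF assms, of "[a, b]"]
    by (simp add: hochschild_d_eq contract_def mult_pair_def algebra_simps)
qed

text \<open>
  This replaces the injectivity of \<open>hkr\<close>: only the polyvector fields of \<open>f\<close> and \<open>g\<close> enter the
  polyvector field of their bracket, whatever representatives \<open>inv_into\<close> selects.
\<close>

lemma antisymmetrize_circle_product_cong:
  assumes "f \<in> hochschild_cocycles p" "f' \<in> hochschild_cocycles p"
    and "g \<in> bar_cochains q" "g' \<in> bar_cochains q"
    and "antisymmetrize p f = antisymmetrize p f'" "antisymmetrize q g = antisymmetrize q g'"
  shows "antisymmetrize (p + q - 1) (circle_product p q f g) xs
    = antisymmetrize (p + q - 1) (circle_product p q f' g') xs"
  using assms
proof (induction xs arbitrary: p q f f' g g')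
  case Nil
  show ?case
  \<comment> \<open>Only in these degrees can the empty list give a nonzero value. Here
    \<open>g []\<close> is an arbitrary element of \<open>S(V)\<close>, so \<open>f\<close> and
    \<open>f'\<close> must agree beyond \<open>V\<close>; being derivations, they do.\<close>
  proof (cases "p = 1 \<and> q = 0")
    case True
    then have "f [sym_incl u] = f' [sym_incl u]" for u
      using antisymmetrize_1[of f u] antisymmetrize_1[of f' u] Nil.prems(5) by metis
    moreover have "derivation (\<lambda>a. f [a])" "derivation (\<lambda>a. f' [a])"
      using Nil.prems(1,2) True by (simp_all add: cocycle_1_derivation)
    ultimately have "f [a] = f' [a]" for a
      using derivation_sym_eqI[of "\<lambda>a. f [a]" "\<lambda>a. f' [a]"] by blast
    moreover have "g [] = g' []"
      using Nil.prems(6) True antisymmetrize_0[of g "[]"] antisymmetrize_0[of g' "[]"] by metis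
    ultimately show ?thesis
      using True by (simp add: antisymmetrize_0 circle_product_eq contract_def)
  next
    case False
    then show ?thesis
      by (cases "p = 0") (auto simp: antisymmetrize_def)
  qed
next
  case (Cons x xs)
  note f = Cons.prems(1,2) and g = Cons.prems(3,4) and eq = Cons.prems(5,6)
  show ?case
  proof (cases "p = 0 \<or> p + q - 1 = 0")
    case True
    then show ?thesis
      by (auto simp: antisymmetrize_def)
  next
    case False
    then obtain m where m: "p + q - 1 = Suc m" "p - 1 + q - 1 = m"
      by (cases "p + q - 1") auto
    let ?x = "sym_incl x"
    \<comment> \<open>Contraction with the head, followed by the pre-Lie identity, distributes
      \<open>x\<close> over the two factors.\<close>
    have expand: "antisymmetrize (p + q - 1) (circle_product p q h k) (x # xs) =
        antisymmetrize m (circle_product p (q - 1) h (insertion q ?x k)) xs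
        + (- 1) ^ (q + 1) * antisymmetrize m (circle_product (p - 1) q (insertion p ?x h) k) xs"
      if "h \<in> hochschild_cocycles p" for h k :: "'a sym list \<Rightarrow> 'a sym"
      unfolding m antisymmetrize_Cons antisymmetrize_add[symmetric]
      using insertion_circle_product[OF hochschild_cocyclesD(1)[OF that], where q = q and x = ?x and g = k]
      by (intro antisymmetrize_cong) (simp only: m)
    have "antisymmetrize m (circle_product p (q - 1) f (insertion q ?x g)) xs =
        antisymmetrize m (circle_product p (q - 1) f' (insertion q ?x g')) xs"
    proof (cases q)
      \<comment> \<open>Then \<open>p = m + 2\<close>, and lists of length \<open>m\<close> are too
        short for \<open>circle_product p 0\<close>.\<close>
      case 0
      then have "antisymmetrize m (circle_product p (q - 1) h k) xs = antisymmetrize m (\<lambda>_. 0) xs" for h k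
        using m by (intro antisymmetrize_cong circle_product_outside) auto
      then show ?thesis
        by simp
    next
      case (Suc n)
      then have "p + n - 1 = m"
        using m False by auto
      moreover have "antisymmetrize n (insertion q ?x g) = antisymmetrize n (insertion q ?x g')"
        unfolding Suc antisymmetrize_Cons[symmetric] using eq(2) Suc by simp
      ultimately show ?thesis
        using Cons.IH[OF f, where q = n and g = "insertion q ?x g" and g' = "insertion q ?x g'"] eq g Suc
          circle_product_bar_cochains[OF g(1) cochain0_bar_cochains[of ?x]]
          circle_product_bar_cochains[OF g(2) cochain0_bar_cochains[of ?x]]
        by simp
    qed
    \<comment> \<open>The induction hypothesis asks for a cocycle as first factor, which
      \<open>insertion_cocycle\<close> supplies.\<close>
    moreover have "antisymmetrize m (circle_product (p - 1) q (insertion p ?x f) g) xs =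
        antisymmetrize m (circle_product (p - 1) q (insertion p ?x f') g') xs"
    proof -
      obtain n where p: "p = Suc n"
        using False by (cases p) auto
      have "antisymmetrize n (insertion p ?x f) = antisymmetrize n (insertion p ?x f')"
        unfolding p antisymmetrize_Cons[symmetric] using eq(1) p by simp
      then show ?thesis
        using Cons.IH[where p = n and f = "insertion p ?x f" and f' = "insertion p ?x f'", OF _ _ g] eq(2) m p
          insertion_cocycle[OF f(1), where x = ?x] insertion_cocycle[OF f(2), where x = ?x]
        by simp
    qed
    ultimately show ?thesis
      using expand[OF f(1), of g] expand[OF f(2), of g'] by simp
  qed
qed

section \<open>Partial derivatives\<close>

text \<open>The formal derivation of the free algebra that sends the variable of \<open>u\<close> to
  the constant \<open>\<phi> u\<close>, on monomials. As \<open>u\<close> runs over the support, the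
  exponents are true differences.\<close>

definition monomial_deriv :: "('v \<Rightarrow> complex) \<Rightarrow> ('v \<Rightarrow>\<^sub>0 nat) \<Rightarrow> 'v free_calg"
  where "monomial_deriv \<phi> m = (\<Sum>u\<in>Poly_Mapping.keys m.
    Poly_Mapping.single (m - Poly_Mapping.single u 1) (of_nat (Poly_Mapping.lookup m u) * \<phi> u))"

definition free_deriv :: "('v \<Rightarrow> complex) \<Rightarrow> 'v free_calg \<Rightarrow> 'v free_calg"
  where "free_deriv \<phi> a = (\<Sum>m\<in>Poly_Mapping.keys a.
    free_const (Poly_Mapping.lookup a m) * monomial_deriv \<phi> m)"

text \<open>Outside the support the coefficient is 0, so sums for several monomials can share one
  index set.\<close>

lemma monomial_deriv_superset:
  assumes "finite A" "Poly_Mapping.keys m \<subseteq> A"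
  shows "monomial_deriv \<phi> m = (\<Sum>u\<in>A.
    Poly_Mapping.single (m - Poly_Mapping.single u 1) (of_nat (Poly_Mapping.lookup m u) * \<phi> u))"
  unfolding monomial_deriv_def using assms
  by (intro sum.mono_neutral_left) (auto simp: in_keys_iff)

lemma free_deriv_superset:
  assumes "finite A" "Poly_Mapping.keys a \<subseteq> A"
  shows "free_deriv \<phi> a = (\<Sum>m\<in>A. free_const (Poly_Mapping.lookup a m) * monomial_deriv \<phi> m)"
  unfolding free_deriv_def using assms
  by (intro sum.mono_neutral_left) (auto simp: in_keys_iff free_const_def)

lemma free_deriv_add: "free_deriv \<phi> (a + b) = free_deriv \<phi> a + free_deriv \<phi> b"
proof -
  let ?A = "Poly_Mapping.keys a \<union> Poly_Mapping.keys b"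
  have "Poly_Mapping.keys (a + b) \<subseteq> ?A"
    by (rule Poly_Mapping.keys_add)
  then show ?thesis
    by (simp add: free_deriv_superset[of ?A] lookup_add free_const_simps distrib_right sum.distrib)
qed

lemma free_deriv_single:
  "free_deriv \<phi> (Poly_Mapping.single m c) = free_const c * monomial_deriv \<phi> m"
  by (simp add: free_deriv_superset[of "{m}"])

lemma free_deriv_zero: "free_deriv \<phi> 0 = 0"
  by (simp add: free_deriv_def)

lemma free_deriv_diff: "free_deriv \<phi> (a - b) = free_deriv \<phi> a - free_deriv \<phi> b"
  using free_deriv_add[of \<phi> "a - b" b] by simp

lemma monomial_deriv_add:
  "monomial_deriv \<phi> (m + m') = monomial_deriv \<phi> m * Poly_Mapping.single m' 1
    + Poly_Mapping.single m 1 * monomial_deriv \<phi> m'"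
proof -
  let ?A = "Poly_Mapping.keys m \<union> Poly_Mapping.keys m'"
  let ?e = "\<lambda>u. Poly_Mapping.single u (1 :: nat)"
  let ?t = "\<lambda>m u. Poly_Mapping.single (m - ?e u) (of_nat (Poly_Mapping.lookup m u) * \<phi> u)"
  have shift: "m - ?e u + m' = m + m' - ?e u" if "Poly_Mapping.lookup m u \<noteq> 0"
    for m m' :: "'a \<Rightarrow>\<^sub>0 nat" and u
    using that by (intro poly_mapping_eqI) (auto simp: lookup_add lookup_minus lookup_single when_def)
  \<comment> \<open>If \<open>u\<close> does not occur in \<open>m\<close>, the exponent truncates,
    but then the coefficient is 0.\<close>
  have move: "?t m u * Poly_Mapping.single m' 1 =
      Poly_Mapping.single (m + m' - ?e u) (of_nat (Poly_Mapping.lookup m u) * \<phi> u)"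
    for m m' :: "'a \<Rightarrow>\<^sub>0 nat" and u
    by (cases "Poly_Mapping.lookup m u = 0") (simp_all add: mult_single shift del: One_nat_def)
  have "Poly_Mapping.keys (m + m') \<subseteq> ?A"
    by (rule Poly_Mapping.keys_add)
  then have "monomial_deriv \<phi> (m + m') = (\<Sum>u\<in>?A. ?t (m + m') u)"
    by (intro monomial_deriv_superset) auto
  also have "\<dots> = (\<Sum>u\<in>?A. ?t m u * Poly_Mapping.single m' 1 + ?t m' u * Poly_Mapping.single m 1)"
    unfolding move by (simp add: lookup_add add.commute[of m'] distrib_right single_add)
  also have "\<dots> = (\<Sum>u\<in>?A. ?t m u) * Poly_Mapping.single m' 1 + (\<Sum>u\<in>?A. ?t m' u) * Poly_Mapping.single m 1"
    by (simp only: sum.distrib sum_distrib_right)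
  also have "(\<Sum>u\<in>?A. ?t m u) = monomial_deriv \<phi> m"
    by (rule monomial_deriv_superset[symmetric]) auto
  also have "(\<Sum>u\<in>?A. ?t m' u) = monomial_deriv \<phi> m'"
    by (rule monomial_deriv_superset[symmetric]) auto
  finally show ?thesis
    by (simp add: mult.commute)
qed

lemma free_deriv_mult: "free_deriv \<phi> (a * b) = free_deriv \<phi> a * b + a * free_deriv \<phi> b"
proof (induction a rule: poly_mapping_add_induct)
  case (add a m c)
  have "free_deriv \<phi> (Poly_Mapping.single m c * b) =
      free_deriv \<phi> (Poly_Mapping.single m c) * b + Poly_Mapping.single m c * free_deriv \<phi> b"
  proof (induction b rule: poly_mapping_add_induct)
    case (add b m' c')
    have single: "Poly_Mapping.single k d = free_const d * Poly_Mapping.single k 1"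
      for k :: "'a \<Rightarrow>\<^sub>0 nat" and d
      by (simp add: free_const_def mult_single)
    have "free_deriv \<phi> (Poly_Mapping.single m c * Poly_Mapping.single m' c') =
      free_deriv \<phi> (Poly_Mapping.single m c) * Poly_Mapping.single m' c' +
      Poly_Mapping.single m c * free_deriv \<phi> (Poly_Mapping.single m' c')"
      unfolding mult_single[of m c m' c'] free_deriv_single monomial_deriv_add
      unfolding single[of m c] single[of m' c']
      by (simp add: free_const_simps algebra_simps)
    with add show ?case
      by (simp add: free_deriv_add algebra_simps)
  qed (simp add: free_deriv_zero)
  with add show ?case
    by (simp add: free_deriv_add algebra_simps)
qed (simp add: free_deriv_zero)

lemma free_deriv_free_const: "free_deriv \<phi> (free_const c) = 0"
  by (simp add: free_const_def free_deriv_single monomial_deriv_def)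

lemma free_deriv_free_var: "free_deriv \<phi> (free_var u) = free_const (\<phi> u)"
  by (simp add: free_var_def free_deriv_single monomial_deriv_def free_const_def mult_single)

text \<open>For linear \<open>\<phi>\<close> the generators of the ideal have derivative 0. By the
  Leibniz rule a multiple \<open>r * g\<close> of a generator then has derivative
  \<open>free_deriv \<phi> r * g\<close>, again in the ideal.\<close>

lemma free_deriv_sym_ideal:
  assumes "\<And>u w. \<phi> (u + w) = \<phi> u + \<phi> w" "\<And>c u. \<phi> (c *\<^sub>C u) = c * \<phi> u"
    and "a \<in> sym_ideal"
  shows "free_deriv \<phi> a \<in> sym_ideal"
  using assms(3) unfolding sym_ideal_def
proof (induction rule: Modules.module.span_induct_alt[OF module_mult, consumes 1, case_names base step])
  case base
  then show ?case
    using sym_ideal_zero by (simp add: free_deriv_zero sym_ideal_def)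
next
  case (step r g b)
  have "free_deriv \<phi> g = 0"
    using step(1) by (auto simp: free_deriv_diff free_deriv_mult free_deriv_free_const
        free_deriv_free_var assms(1,2) free_const_simps)
  moreover have "g \<in> sym_ideal"
    unfolding sym_ideal_def using step(1) by (rule Modules.module.span_base[OF module_mult])
  ultimately show ?case
    using step(2) sym_ideal_add[OF sym_ideal_mult[of g "free_deriv \<phi> r"], of "free_deriv \<phi> b"]
    by (simp add: free_deriv_add free_deriv_mult sym_ideal_def)
qed

lemma derivation_sym_exists:
  fixes \<phi> :: "'v::complex_vector \<Rightarrow> complex"
  assumes "\<And>u w. \<phi> (u + w) = \<phi> u + \<phi> w" "\<And>c u. \<phi> (c *\<^sub>C u) = c * \<phi> u"
  obtains D where "derivation D" "\<And>u. D (sym_incl u) = \<phi> u *\<^sub>C 1"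
proof
  define D where "D s = abs_sym (free_deriv \<phi> (rep_sym s))" for s
  \<comment> \<open>The choice of representative is immaterial because the formal derivation
    preserves the ideal.\<close>
  have D_abs: "D (abs_sym a) = abs_sym (free_deriv \<phi> a)" for a
  proof -
    have "sym_rel (rep_sym (abs_sym a)) a"
      by (rule Quotient3_rep_abs[OF Quotient3_sym]) (rule equivp_reflp[OF equivp_sym_rel])
    then have "sym_rel (free_deriv \<phi> (rep_sym (abs_sym a))) (free_deriv \<phi> a)"
      unfolding sym_rel_def free_deriv_diff[symmetric] by (intro free_deriv_sym_ideal assms)
    then show ?thesis
      unfolding D_def by (simp add: sym.abs_eq_iff)
  qed
  have abs: "\<exists>a. s = abs_sym a" for s :: "'v sym"
    by (metis Quotient3_abs_rep Quotient3_sym)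
  have "D (s + t) = D s + D t" "D (s * t) = D s * t + s * D t" "D (c *\<^sub>C s) = c *\<^sub>C D s" for s t c
    using abs[of s] abs[of t]
    by (auto simp: D_abs plus_sym.abs_eq times_sym.abs_eq scaleC_sym.abs_eq free_deriv_add
        free_deriv_mult free_deriv_free_const)
  then show "derivation D"
    unfolding derivation_def by (auto intro: clinearI)
  show "D (sym_incl u) = \<phi> u *\<^sub>C 1" for u
    by (simp add: sym_incl.abs_eq D_abs free_deriv_free_var one_sym_def scaleC_sym.abs_eq)
qed

text \<open>Justifies the definite description in \<open>partial_deriv\<close>: the dual basis
  functional extends to a derivation, and values on the basis fix those on \<open>V\<close> by
  linearity, hence the whole derivation.\<close>

lemma
  fixes v :: "nat \<Rightarrow> 'v::complex_vector"
  assumes basis: "is_basis n v" and j: "j \<in> {1..n}"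
  shows partial_deriv_derivation: "derivation (partial_deriv n v j)"
    and partial_deriv_sym_incl: "partial_deriv n v j (sym_incl u) = dual_basis n v j u *\<^sub>C 1"
proof -
  let ?B = "v ` {1..n}"
  have ind: "complex_vector.independent ?B" and span: "u \<in> complex_vector.span ?B"
    and inj: "inj_on v {1..n}" for u
    using basis by (simp_all add: is_basis_def)
  have "dual_basis n v j (u + w) = dual_basis n v j u + dual_basis n v j w" for u w
    unfolding dual_basis_def complex_vector.representation_add[OF ind span span] by simp
  moreover have "dual_basis n v j (c *\<^sub>C u) = c * dual_basis n v j u" for c u
    unfolding dual_basis_def complex_vector.representation_scale[OF ind span] by simp
  ultimately obtain D where D: "derivation D" "\<And>u. D (sym_incl u) = dual_basis n v j u *\<^sub>C 1"
    using derivation_sym_exists[of "dual_basis n v j"] by blast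
  have D_basis: "D (sym_incl (v i)) = (if i = j then 1 else 0)" if "i \<in> {1..n}" for i
  proof -
    have "v i = v j \<longleftrightarrow> i = j"
      using inj that j by (auto dest: inj_onD)
    moreover have "dual_basis n v j (v i) = (if v j = v i then 1 else 0)"
      unfolding dual_basis_def using that
      by (subst complex_vector.representation_basis[OF ind]) auto
    ultimately show ?thesis
      by (auto simp: D(2) scaleC_one complex_vector.scale_zero_left)
  qed
  have "partial_deriv n v j = D"
    unfolding partial_deriv_def
  proof (rule the_equality)
    show "clinear D \<and> (\<forall>a b. D (a * b) = D a * b + a * D b) \<and>
        (\<forall>i\<in>{1..n}. D (sym_incl (v i)) = (if i = j then 1 else 0))"
      using D(1) D_basis by (simp add: derivation_def)
  next
    fix E assume E: "clinear E \<and> (\<forall>a b. E (a * b) = E a * b + a * E b) \<and>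
        (\<forall>i\<in>{1..n}. E (sym_incl (v i)) = (if i = j then 1 else 0))"
    have "clinear E" "clinear D"
      using E D(1) by (simp_all add: derivation_def)
    note lin = this[THEN clinear_compose, OF clinear_sym_incl]
    have "E (sym_incl u) = D (sym_incl u)" for u
      using span[of u]
    proof (induction rule: complex_vector.span_induct_alt)
      case base
      show ?case
        using lin[THEN clinear_zero] by simp
    next
      case (step c x y)
      then have "E (sym_incl x) = D (sym_incl x)"
        using E D_basis by auto
      with step(2) show ?case
        by (simp only: lin[THEN clinear_add] lin[THEN clinear_scale])
    qed
    moreover have "derivation E"
      using E by (simp add: derivation_def)
    ultimately have "E s = D s" for s
      using derivation_sym_eqI[OF _ D(1)] by blast
    then show "E = D"
      by (rule ext)
  qed
  with D show "derivation (partial_deriv n v j)"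
    "partial_deriv n v j (sym_incl u) = dual_basis n v j u *\<^sub>C 1"
    by simp_all
qed

section \<open>The bracket of polyvector fields\<close>

lemma cohomologous_refl:
  fixes f :: "'a::complex_algebra_1 list \<Rightarrow> 'a"
  assumes "f \<in> hochschild_cocycles p"
  shows "(f, f) \<in> cohomologous p"
proof -
  have "(\<lambda>_. 0 :: 'a) \<in> hochschild_coboundaries p"
  proof (cases p)
    case (Suc m)
    have "(\<lambda>_. 0 :: 'a) = hochschild_d m (\<lambda>_. 0)"
      by (simp add: hochschild_d_def fun_eq_iff)
    moreover have "(\<lambda>_. 0 :: 'a) \<in> bar_cochains m"
      by (simp add: bar_cochains_def clinear_const_zero)
    ultimately show ?thesis
      using Suc by (auto simp: hochschild_coboundaries_def)
  qed (simp add: hochschild_coboundaries_def)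
  with assms show ?thesis
    by (simp add: cohomologous_def)
qed

text \<open>This makes \<open>hkr\<close> well defined on classes. Degree 0 is separate, as its only
  coboundary is zero.\<close>

lemma antisymmetrize_cohomologous:
  assumes "(f, g) \<in> cohomologous p"
  shows "antisymmetrize p f = antisymmetrize p g"
proof (cases p)
  case 0
  then have "(\<lambda>as. f as - g as) = (\<lambda>_. 0)"
    using assms by (simp add: cohomologous_def hochschild_coboundaries_def)
  then have "f = g"
    by (simp add: fun_eq_iff)
  then show ?thesis
    by simp
next
  case (Suc m)
  then obtain h where h: "h \<in> bar_cochains m" "(\<lambda>as. f as - g as) = hochschild_d m h"
    using assms by (auto simp: cohomologous_def hochschild_coboundaries_def)
  have "antisymmetrize p f xs - antisymmetrize p g xs = antisymmetrize p (\<lambda>as. f as - g as) xs" for xs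
    using antisymmetrize_diff[of p f 0 g xs] by simp
  then have "antisymmetrize p f xs - antisymmetrize p g xs = 0" for xs
    using antisymmetrize_hochschild_d[OF h(1)] by (simp add: h(2) Suc)
  then show ?thesis
    by (simp add: fun_eq_iff)
qed

lemma the_elem_image_const:
  assumes "x \<in> X" "\<And>y. y \<in> X \<Longrightarrow> f y = c"
  shows "the_elem (f ` X) = c"
proof -
  have "f ` X = {c}"
    using assms by auto
  then show ?thesis
    by simp
qed

lemma hkr_class:
  assumes "X \<in> HH p" "f \<in> X"
  shows "f \<in> hochschild_cocycles p" "hkr p X = antisymmetrize p f"
proof -
  obtain f0 where X: "X = cohomologous p `` {f0}"
    using assms(1) by (auto simp: HH_def quotient_def)
  then have f: "(f0, f) \<in> cohomologous p"
    using assms(2) by simp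
  then show "f \<in> hochschild_cocycles p"
    by (simp add: cohomologous_def)
  have "antisymmetrize p h = antisymmetrize p f" if "h \<in> X" for h
    using that X antisymmetrize_cohomologous[OF f] antisymmetrize_cohomologous[of f0 h p] by simp
  with assms(2) show "hkr p X = antisymmetrize p f"
    unfolding hkr_def by (rule the_elem_image_const)
qed

lemma HH_nonempty:
  assumes "X \<in> HH p"
  obtains f where "f \<in> X"
proof -
  obtain f where "f \<in> hochschild_cocycles p" "X = cohomologous p `` {f}"
    using assms by (auto simp: HH_def quotient_def)
  then have "f \<in> X"
    using cohomologous_refl by simp
  then show ?thesis ..
qed

text \<open>Ensures that \<open>inv_into\<close> in \<open>polyvector_bracket\<close> selects a true
  preimage.\<close>

lemma antisymmetrize_in_hkr_image:
  assumes "f \<in> hochschild_cocycles p"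
  shows "antisymmetrize p f \<in> hkr p ` HH p"
proof -
  have "cohomologous p `` {f} \<in> HH p" "f \<in> cohomologous p `` {f}"
    using assms cohomologous_refl by (auto simp: HH_def quotient_def)
  then show ?thesis
    using hkr_class(2) by (metis image_eqI)
qed

section \<open>Explicit cocycles for polyvector fields\<close>

abbreviation apply_all :: "('a \<Rightarrow> 'b) list \<Rightarrow> 'a list \<Rightarrow> 'b list"
  where "apply_all \<equiv> map2 (\<lambda>D a. D a)"

text \<open>The cup product of derivations, multiplied by \<open>f\<close>; it represents \<open>f \<otimes> dv\<^sub>J\<close> for partial derivatives.\<close>

definition derivation_cochain ::
    "'a::{complex_algebra_1, comm_ring_1} \<Rightarrow> ('a \<Rightarrow> 'a) list \<Rightarrow> 'a list \<Rightarrow> 'a"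
  where "derivation_cochain f Ds as =
    (if length as = length Ds then f * prod_list (apply_all Ds as) else 0)"

text \<open>In the differential of a cup product of derivations each inner product contributes two
  neighbouring terms \<open>U\<close>; what survives cancels against the two outer terms.\<close>

lemma sum_alternating_telescope:
  fixes U :: "nat \<Rightarrow> 'a::ring_1"
  shows "(\<Sum>k<p. (- 1) ^ (k + 1) * (U (k + 1) + U k)) = (- 1) ^ p * U p - U 0"
  by (induction p) (simp_all add: distrib_left)

lemma derivation_cochain_cocycle:
  fixes f :: "'a::{complex_algebra_1, comm_ring_1}"
  assumes "\<And>D. D \<in> set Ds \<Longrightarrow> derivation D"
  shows "derivation_cochain f Ds \<in> hochschild_cocycles (length Ds)"
proof -
  let ?p = "length Ds"
  have "hochschild_d ?p (derivation_cochain f Ds) as = 0" for as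
  proof (cases "length as = ?p + 1")
    case True
    \<comment> \<open>\<open>U k\<close> leaves entry \<open>k\<close>, counted from 0, underived,
      and the derivations from number \<open>k\<close> on act one entry further right. The Leibniz
      rule at \<open>k\<close> produces \<open>U (k + 1)\<close> and \<open>U k\<close>.\<close>
    define U where "U k = prod_list (apply_all (take k Ds) (take k as)) * as ! k *
      prod_list (apply_all (drop k Ds) (drop (k + 1) as))" for k
    have "derivation_cochain f Ds (contract 2 mult_pair k as) = f * (U (k + 1) + U k)" if k: "k < ?p" for k
    proof -
      have Ds: "Ds = take k Ds @ Ds ! k # drop (k + 1) Ds"
        using k id_take_nth_drop[of k Ds] by simp
      have "derivation (Ds ! k)"
        using k assms by simp
      then have "(Ds ! k) (as ! k * as ! (k + 1))
          = (Ds ! k) (as ! k) * as ! (k + 1) + as ! k * (Ds ! k) (as ! (k + 1))"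
        by (simp add: derivation_def)
      moreover have "derivation_cochain f Ds (contract 2 mult_pair k as) =
          f * (prod_list (apply_all (take k Ds) (take k as)) * (Ds ! k) (as ! k * as ! (k + 1)) *
            prod_list (apply_all (drop (k + 1) Ds) (drop (k + 2) as)))"
        using k True by (subst (1) Ds)
          (simp add: derivation_cochain_def contract_def mult_pair_def mult.assoc)
      moreover have "U (k + 1) = prod_list (apply_all (take k Ds) (take k as)) * (Ds ! k) (as ! k) *
          as ! (k + 1) * prod_list (apply_all (drop (k + 1) Ds) (drop (k + 2) as))"
        using k True by (simp add: U_def take_Suc_conv_app_nth)
      moreover have "U k = prod_list (apply_all (take k Ds) (take k as)) * as ! k *
          ((Ds ! k) (as ! (k + 1)) * prod_list (apply_all (drop (k + 1) Ds) (drop (k + 2) as)))"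
        using k True by (simp add: U_def Cons_nth_drop_Suc[symmetric])
      ultimately show ?thesis
        by (simp add: algebra_simps)
    qed
    then have "(\<Sum>k<?p. (- 1) ^ (k + 1) * derivation_cochain f Ds (contract 2 mult_pair k as)) =
        f * (\<Sum>k<?p. (- 1) ^ (k + 1) * (U (k + 1) + U k))"
      by (simp add: sum_distrib_left mult.left_commute)
    moreover have "hd as * derivation_cochain f Ds (tl as) = f * U 0"
      using True by (cases as) (simp_all add: derivation_cochain_def U_def)
    moreover have "derivation_cochain f Ds (butlast as) * last as = f * U ?p"
      using True by (cases as rule: rev_cases)
        (simp_all add: derivation_cochain_def U_def nth_append mult.assoc)
    ultimately show ?thesis
      unfolding hochschild_d_eq[OF True] sum_alternating_telescope by (simp add: algebra_simps)
  qed (simp add: hochschild_d_def)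
  moreover have "derivation_cochain f Ds \<in> bar_cochains ?p"
  proof (rule bar_cochainsI)
    fix us vs :: "'a list"
    assume len: "length us + length vs + 1 = ?p"
    let ?k = "length us"
    have Ds: "Ds = take ?k Ds @ Ds ! ?k # drop (?k + 1) Ds"
      using len id_take_nth_drop[of ?k Ds] by simp
    have "clinear (Ds ! ?k)"
      using len assms by (simp add: derivation_def)
    then have "clinear (\<lambda>a. f * (prod_list (apply_all (take ?k Ds) us) * (Ds ! ?k) a *
        prod_list (apply_all (drop (?k + 1) Ds) vs)))"
      by (intro clinear_mult_left clinear_mult_right)
    moreover have "derivation_cochain f Ds (us @ a # vs) =
        f * (prod_list (apply_all (take ?k Ds) us) * (Ds ! ?k) a *
          prod_list (apply_all (drop (?k + 1) Ds) vs))" for a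
      using len by (subst (1) Ds) (simp add: derivation_cochain_def mult.assoc)
    ultimately show "clinear (\<lambda>a. derivation_cochain f Ds (us @ a # vs))"
      by simp
  qed (simp add: derivation_cochain_def)
  ultimately show ?thesis
    by (simp add: hochschild_cocycles_def fun_eq_iff)
qed

abbreviation polyvector_cochain ::
    "nat \<Rightarrow> (nat \<Rightarrow> 'v::complex_vector) \<Rightarrow> 'v sym \<Rightarrow> nat list \<Rightarrow> 'v sym list \<Rightarrow> 'v sym"
  where "polyvector_cochain n v f J \<equiv> derivation_cochain f (map (partial_deriv n v) J)"

lemma prod_scaleC_one:
  "(\<Prod>i\<in>A. c i *\<^sub>C (1 :: 'a::{complex_algebra_1, comm_ring_1})) = (\<Prod>i\<in>A. c i) *\<^sub>C 1"
  by (induction A rule: infinite_finite_induct)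
    (simp_all add: scaleC_one mult_scaleC_left scaleC_scaleC)

section \<open>Computation with partial derivatives along a basis\<close>

context
  fixes n :: nat and v :: "nat \<Rightarrow> 'v::complex_vector"
  assumes basis: "is_basis n v"
begin

lemma polyvector_cochain_cocycle:
  assumes "set J \<subseteq> {1..n}"
  shows "polyvector_cochain n v f J \<in> hochschild_cocycles (length J)"
proof -
  have "derivation D" if "D \<in> set (map (partial_deriv n v) J)" for D
    using that assms partial_deriv_derivation[OF basis] by (auto simp del: atLeastAtMost_iff)
  then show ?thesis
    using derivation_cochain_cocycle[of "map (partial_deriv n v) J" f] by (simp only: length_map)
qed

lemma prod_list_partial_deriv:
  assumes "set J \<subseteq> {1..n}" "length ys = length J"
  shows "prod_list (apply_all (map (partial_deriv n v) J) (map sym_incl ys))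
    = (\<Prod>i = 0..<length J. dual_basis n v (J ! i) (ys ! i)) *\<^sub>C 1"
proof -
  have "partial_deriv n v (J ! i) (sym_incl (ys ! i)) = dual_basis n v (J ! i) (ys ! i) *\<^sub>C 1"
    if "i < length J" for i
    using that assms(1) by (intro partial_deriv_sym_incl[OF basis]) (use nth_mem in blast)
  then show ?thesis
    using assms(2) by (simp add: prod.list_conv_set_nth prod_scaleC_one[symmetric])
qed

lemma antisymmetrize_polyvector_cochain:
  assumes J: "set J \<subseteq> {1..n}"
  shows "antisymmetrize (length J) (polyvector_cochain n v f J) xs = polyvector n v f J xs"
proof (cases "length xs = length J")
  case True
  let ?p = "length J"
  have sign: "of_int (sign \<pi>) * a = of_int (sign \<pi>) *\<^sub>C a" for \<pi> :: "nat \<Rightarrow> nat" and a :: "'v sym"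
    by (simp add: sign_def scaleC_one scaleC_minus_one)
  have "antisymmetrize ?p (polyvector_cochain n v f J) xs =
      (\<Sum>\<pi> | \<pi> permutes {..<?p}. of_int (sign \<pi>) *
        (f * ((\<Prod>i = 0..<?p. dual_basis n v (J ! i) (xs ! \<pi> i)) *\<^sub>C 1)))"
    using True unfolding antisymmetrize_def
    by (auto intro!: sum.cong prod.cong
        simp: derivation_cochain_def prod_list_partial_deriv[OF J] permute_list_nth)
  also have "\<dots> = (\<Sum>\<pi> | \<pi> permutes {..<?p}.
      (of_int (sign \<pi>) * (\<Prod>i = 0..<?p. dual_basis n v (J ! i) (xs ! \<pi> i))) *\<^sub>C f)"
    unfolding sign by (simp add: mult_scaleC_right scaleC_scaleC)
  also have "\<dots> = (\<Sum>\<pi> | \<pi> permutes {..<?p}.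
      of_int (sign \<pi>) * (\<Prod>i = 0..<?p. dual_basis n v (J ! i) (xs ! \<pi> i))) *\<^sub>C f"
    by (rule complex_vector.scale_sum_left[symmetric])
  also have "(\<Sum>\<pi> | \<pi> permutes {..<?p}.
      of_int (sign \<pi>) * (\<Prod>i = 0..<?p. dual_basis n v (J ! i) (xs ! \<pi> i)))
      = det (mat ?p ?p (\<lambda>(i, k). dual_basis n v (J ! i) (xs ! k)))"
    by (subst det_def'[of _ ?p])
      (auto intro!: sum.cong prod.cong dest: permutes_in_image simp: lessThan_atLeast0)
  finally show ?thesis
    using True by (simp add: polyvector_def)
qed (simp add: antisymmetrize_def polyvector_def)

text \<open>On vectors the inner derivatives are scalars, so the derivation in slot \<open>k\<close>
  differentiates \<open>g\<close> only. Agreement on lists from \<open>V\<close> suffices for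
  antisymmetrization.\<close>

lemma circle_product_polyvector_cochain:
  assumes J: "set J \<subseteq> {1..n}" and L: "set L \<subseteq> {1..n}"
    and ys: "length ys + 1 = length J + length L"
  shows "circle_product (length J) (length L) (polyvector_cochain n v f J) (polyvector_cochain n v g L)
      (map sym_incl ys)
    = (\<Sum>k<length J. (- 1) ^ ((length L + 1) * k) *
      polyvector_cochain n v (partial_deriv n v (J ! k) g * f) (take k J @ L @ drop (k + 1) J)
        (map sym_incl ys))"
proof -
  let ?p = "length J" and ?q = "length L"
  let ?D = "partial_deriv n v"
  let ?as = "map sym_incl ys"
  have "polyvector_cochain n v f J (contract ?q (polyvector_cochain n v g L) k ?as) =
      polyvector_cochain n v (?D (J ! k) g * f) (take k J @ L @ drop (k + 1) J) ?as" if k: "k < ?p" for k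
  proof -
    define us where "us = map sym_incl (take k ys)"
    define bs where "bs = map sym_incl (take ?q (drop k ys))"
    define vs where "vs = map sym_incl (drop (k + ?q) ys)"
    have as: "?as = us @ bs @ vs"
      unfolding us_def bs_def vs_def map_append[symmetric]
      using k ys by (subst list_split_at[of k ?q ys]) auto
    have len: "length us = k" "length bs = ?q" "length vs + k + 1 = ?p"
      using k ys by (simp_all add: us_def bs_def vs_def)
    have JL: "J = take k J @ J ! k # drop (k + 1) J"
      using k id_take_nth_drop[of k J] by simp
    obtain c where c: "prod_list (apply_all (map ?D L) bs) = c *\<^sub>C 1"
      using prod_list_partial_deriv[OF L, of "take ?q (drop k ys)"] len(2) by (auto simp: bs_def)
    have "derivation (?D (J ! k))"
      using k J by (intro partial_deriv_derivation[OF basis]) (use nth_mem in blast)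
    then have "?D (J ! k) (g * (c *\<^sub>C 1)) = ?D (J ! k) g * (c *\<^sub>C 1)"
      using derivation_scalar[of "?D (J ! k)" c] by (simp only: derivation_def) simp
    then have "?D (J ! k) (polyvector_cochain n v g L bs) =
        ?D (J ! k) g * prod_list (apply_all (map ?D L) bs)"
      using len by (simp add: derivation_cochain_def c)
    moreover have "contract ?q (polyvector_cochain n v g L) k ?as = us @ polyvector_cochain n v g L bs # vs"
      unfolding as using len by (simp add: contract_append)
    moreover have "polyvector_cochain n v f J (us @ b # vs) =
        f * (prod_list (apply_all (map ?D (take k J)) us) * ?D (J ! k) b *
          prod_list (apply_all (map ?D (drop (k + 1) J)) vs))" for b
      using len by (subst (1) JL) (simp add: derivation_cochain_def mult.assoc)
    moreover have "polyvector_cochain n v (?D (J ! k) g * f) (take k J @ L @ drop (k + 1) J) ?as =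
        ?D (J ! k) g * f * (prod_list (apply_all (map ?D (take k J)) us) *
          (prod_list (apply_all (map ?D L) bs) * prod_list (apply_all (map ?D (drop (k + 1) J)) vs)))"
      unfolding as using len by (simp add: derivation_cochain_def)
    ultimately show ?thesis
      by (simp add: algebra_simps)
  qed
  then show ?thesis
    using ys by (simp add: circle_product_eq)
qed

lemma antisymmetrize_circle_product_polyvector_cochain:
  assumes J: "set J \<subseteq> {1..n}" "length J = p" and L: "set L \<subseteq> {1..n}" "length L = q"
  shows "antisymmetrize (p + q - 1)
      (circle_product p q (polyvector_cochain n v f J) (polyvector_cochain n v g L)) xs
    = (\<Sum>k=1..p. (- 1) powi ((int q - 1) * (int k - 1)) *\<^sub>C
        polyvector n v (partial_deriv n v (J ! (k - 1)) g * f) (take (k - 1) J @ L @ drop k J) xs)"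
\<comment> \<open>For \<open>p = 0\<close> both sides are zero; otherwise \<open>p + q - 1\<close>
  does not truncate and is the length of each \<open>?I k\<close> with \<open>k < p\<close>.\<close>
proof (cases "p = 0")
  case True
  then show ?thesis
    by (simp add: antisymmetrize_def)
next
  case False
  let ?I = "\<lambda>k. take k J @ L @ drop (k + 1) J"
  let ?h = "\<lambda>k. partial_deriv n v (J ! k) g * f"
  have sub: "set (?I k) \<subseteq> {1..n}" for k
    using J(1) L(1) set_take_subset[of k J] set_drop_subset[of "k + 1" J] by auto
  have "antisymmetrize (p + q - 1)
      (circle_product p q (polyvector_cochain n v f J) (polyvector_cochain n v g L)) xs =
    antisymmetrize (p + q - 1)
      (\<lambda>as. \<Sum>k<p. (- 1) ^ ((q + 1) * k) * polyvector_cochain n v (?h k) (?I k) as) xs"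
    using circle_product_polyvector_cochain[OF J(1) L(1)] J(2) L(2) False
    by (intro antisymmetrize_cong) simp
  also have "\<dots> = (\<Sum>k<p. (- 1) ^ ((q + 1) * k) * polyvector n v (?h k) (?I k) xs)"
    unfolding antisymmetrize_sum
  proof (rule sum.cong[OF refl])
    fix k assume "k \<in> {..<p}"
    then have "length (?I k) = p + q - 1"
      using J(2) L(2) by simp
    then show "(- 1) ^ ((q + 1) * k) *
          antisymmetrize (p + q - 1) (polyvector_cochain n v (?h k) (?I k)) xs
        = (- 1) ^ ((q + 1) * k) * polyvector n v (?h k) (?I k) xs"
      using antisymmetrize_polyvector_cochain[OF sub, of k "?h k" xs] by simp
  qed
  also have "\<dots> = (\<Sum>k<p. (- 1) powi ((int q - 1) * (int (Suc k) - 1)) *\<^sub>C polyvector n v (?h k) (?I k) xs)"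
    by (intro sum.cong refl scaleC_minus_one_powi[symmetric]) (simp add: algebra_simps)
  finally show ?thesis
    by (simp add: sum.atLeast1_atMost_eq)
qed

end

theorem corollary7p5:
  fixes v :: "nat \<Rightarrow> 'v::complex_vector"
    and n p q :: nat
    and f\<^sub>1 f\<^sub>2 :: "'v sym"
    and J L :: "nat list"
  assumes "is_basis n v"
    and "length J = p" and "set J \<subseteq> {1..n}"
    and "length L = q" and "set L \<subseteq> {1..n}"
  shows "polyvector_bracket p q (polyvector n v f\<^sub>1 J) (polyvector n v f\<^sub>2 L) = (\<lambda>xs.
      (\<Sum>k=1..p. (- 1) powi ((int q - 1) * (int k - 1)) *\<^sub>C
        polyvector n v (partial_deriv n v (J ! (k - 1)) f\<^sub>2 * f\<^sub>1)
          (take (k - 1) J @ L @ drop k J) xs)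
      - (- 1) powi ((int p - 1) * (int q - 1)) *\<^sub>C
        (\<Sum>k=1..q. (- 1) powi ((int p - 1) * (int k - 1)) *\<^sub>C
          polyvector n v (partial_deriv n v (L ! (k - 1)) f\<^sub>1 * f\<^sub>2)
            (take (k - 1) L @ J @ drop k L) xs))"
    (is "_ = ?rhs")
proof -
  note basis = assms(1) and J = assms(3,2) and L = assms(5,4)
  let ?\<alpha> = "polyvector n v f\<^sub>1 J" and ?\<beta> = "polyvector n v f\<^sub>2 L"
  let ?f = "polyvector_cochain n v f\<^sub>1 J" and ?g = "polyvector_cochain n v f\<^sub>2 L"
  have f: "?f \<in> hochschild_cocycles p" "antisymmetrize p ?f = ?\<alpha>"
    and g: "?g \<in> hochschild_cocycles q" "antisymmetrize q ?g = ?\<beta>"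
    using polyvector_cochain_cocycle[OF basis J(1), of f\<^sub>1] polyvector_cochain_cocycle[OF basis L(1), of f\<^sub>2]
      antisymmetrize_polyvector_cochain[OF basis J(1), of f\<^sub>1]
      antisymmetrize_polyvector_cochain[OF basis L(1), of f\<^sub>2] J(2) L(2)
    by (auto simp: fun_eq_iff)
  \<comment> \<open>The classes selected by \<open>inv_into\<close>; known of them are their images
    \<open>?\<alpha>\<close> and \<open>?\<beta>\<close> under \<open>hkr\<close>.\<close>
  define X where "X = inv_into (HH p) (hkr p) ?\<alpha>"
  define Y where "Y = inv_into (HH q) (hkr q) ?\<beta>"
  have "?\<alpha> \<in> hkr p ` HH p" "?\<beta> \<in> hkr q ` HH q"
    using antisymmetrize_in_hkr_image[OF f(1)] antisymmetrize_in_hkr_image[OF g(1)] f(2) g(2) by simp_all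
  then have X: "X \<in> HH p" "hkr p X = ?\<alpha>" and Y: "Y \<in> HH q" "hkr q Y = ?\<beta>"
    unfolding X_def Y_def by (simp_all add: inv_into_into f_inv_into_f)
  \<comment> \<open>All representatives of \<open>X\<close> and \<open>Y\<close> have the
    antisymmetrizations of \<open>?f\<close> and \<open>?g\<close>, so the antisymmetrized bracket
    can be evaluated on these two.\<close>
  have cocycle: "gerstenhaber p q f' g' \<in> hochschild_cocycles (p + q - 1)"
    and antisymmetrize: "antisymmetrize (p + q - 1) (gerstenhaber p q f' g') = ?rhs"
    if f'g': "f' \<in> X" "g' \<in> Y" for f' g'
  proof -
    note f' = hkr_class[OF X(1) f'g'(1), unfolded X(2)] and g' = hkr_class[OF Y(1) f'g'(2), unfolded Y(2)]
    show "gerstenhaber p q f' g' \<in> hochschild_cocycles (p + q - 1)"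
      using f'(1) g'(1) by (rule gerstenhaber_cocycle)
    have "antisymmetrize (p + q - 1) (circle_product p q f' g') xs =
        antisymmetrize (p + q - 1) (circle_product p q ?f ?g) xs" for xs
      using f' g' f g
      by (intro antisymmetrize_circle_product_cong) (auto dest: hochschild_cocyclesD(1))
    moreover have "antisymmetrize (q + p - 1) (circle_product q p g' f') xs =
        antisymmetrize (q + p - 1) (circle_product q p ?g ?f) xs" for xs
      using f' g' f g
      by (intro antisymmetrize_circle_product_cong) (auto dest: hochschild_cocyclesD(1))
    moreover have "antisymmetrize (p + q - 1) (gerstenhaber p q f' g') xs =
        antisymmetrize (p + q - 1) (circle_product p q f' g') xs
        - (- 1) ^ ((p + 1) * (q + 1)) * antisymmetrize (q + p - 1) (circle_product q p g' f') xs" for xs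
      unfolding add.commute[of q p] antisymmetrize_diff[symmetric]
      by (intro antisymmetrize_cong) (rule gerstenhaber_eq)
    moreover have "(- 1) powi ((int p - 1) * (int q - 1)) *\<^sub>C a = (- 1) ^ ((p + 1) * (q + 1)) * a"
      for a :: "'v sym"
      by (rule scaleC_minus_one_powi) (simp add: algebra_simps)
    ultimately show "antisymmetrize (p + q - 1) (gerstenhaber p q f' g') = ?rhs"
      by (intro ext) (simp only:
          antisymmetrize_circle_product_polyvector_cochain[OF basis J L]
          antisymmetrize_circle_product_polyvector_cochain[OF basis L J])
  qed
  \<comment> \<open>\<open>HH_bracket\<close> is a union of classes over all representatives. It is
    nonempty and all its members antisymmetrize to \<open>?rhs\<close>, so \<open>the_elem\<close>
    in \<open>hkr\<close> returns \<open>?rhs\<close>.\<close>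
  obtain f' g' where "f' \<in> X" "g' \<in> Y"
    using X(1) Y(1) by (metis HH_nonempty)
  then have "gerstenhaber p q f' g' \<in> HH_bracket p q X Y"
    using cohomologous_refl[OF cocycle] by (auto simp: HH_bracket_def)
  moreover have "antisymmetrize (p + q - 1) h = ?rhs" if "h \<in> HH_bracket p q X Y" for h
    using that antisymmetrize antisymmetrize_cohomologous by (fastforce simp: HH_bracket_def)
  ultimately have "hkr (p + q - 1) (HH_bracket p q X Y) = ?rhs"
    unfolding hkr_def by (rule the_elem_image_const)
  then show ?thesis
    by (simp only: polyvector_bracket_def X_def Y_def)
qed

end
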